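(* Let $\mathcal{F}$ be a tree of finite subsets of $\mathbb{N}$ and $M$ an infinite subset of $\mathbb{N}$. Then the following hold. [Case 1] If the family $\mathcal{F}_h\cap[M]^{<\omega}$ is not pointwise closed, then there exists $L\in[M]$ such that $[L]^{<\omega}\subseteq\mathcal{F}$. [Case 2] If the family $\mathcal{F}_h\cap[M]^{<\omega}$ is pointwise closed, then $\zeta^{\mathcal{F}}_M=\sup\{s_L(\mathcal{F}_h):L\in[M]\}$ is a countable ordinal, and for every countable ordinal $\xi$: 2(i) if $\zeta^{\mathcal{F}}_M>\xi+1$, then there exists $L\in[M]$ such that $\mathcal{A}_\xi\cap[L]^{<\omega}\subseteq\mathcal{F}$; 2(ii) if $\zeta^{\mathcal{F}}_M<\xi$, then for every $I\in[M]$ there exists $L\in[I]$ such that $\mathcal{A}_\xi\cap[L]^{<\omega}\subseteq[\mathbb{N}]^{<\omega}\setminus\mathcal{F}$ (equivalently, $\mathcal{F}\cap[L]^{<\omega}\subseteq(\mathcal{A}_\xi)^{\star}\setminus\mathcal{A}_\xi$); 2(iii) if $\zeta^{\mathcal{F}}_M=\xi+1$ or $\zeta^{\mathcal{F}}_M=\xi$, then there exists $L\in[M]$ such that either $\mathcal{A}_\xi\cap[L]^{<\omega}\subseteq\mathcal{F}$ or $\mathcal{A}_\xi\cap[L]^{<\omega}\subseteq[\mathbb{N}]^{<\omega}\setminus\mathcal{F}$.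
   Context: $\mathbb{N}=\{1,2,3,\dots\}$. For $M\subseteq\mathbb{N}$, $[M]^{<\omega}$ is the set of all finite subsets of $M$ (including $\emptyset$) and $[M]$ the set of all infinite subsets of $M$. For $s,t\subseteq\mathbb{N}$ nonempty, $s<t$ means $\max s<\min t$; $\{n\}<\emptyset$ is considered true. Initial segments are with respect to the order of $\mathbb{N}$. For a family $\mathcal{G}$ of finite subsets of $\mathbb{N}$: $\mathcal{G}^{\star}=\{t\in[\mathbb{N}]^{<\omega}: t\text{ is an initial segment of some }s\in\mathcal{G}\}\cup\{\emptyset\}$; $\mathcal{G}$ is a tree if $\mathcal{G}^\star=\mathcal{G}$; $\mathcal{G}$ is hereditary if every subset of an element of $\mathcal{G}$ belongs to $\mathcal{G}$; $\mathcal{G}_h=\{s\in\mathcal{G}:\text{every nonempty subset of }s\text{ belongs to }\mathcal{G}\}\cup\{\emptyset\}$ (for a tree $\mathcal G$, this is the largest hereditary subfamily of $\mathcal G$). Subsets of $\mathbb{N}$ are identified with characteristic functions, and the set of all subsets of $\mathbb{N}$ carries the topology of pointwise convergence; "pointwise closed" refers to this topology. Strong Cantor-Bendixson index: let $\mathcal{G}$ be a hereditary and pointwise closed family of finite subsets of $\mathbb{N}$, $L\in[\mathbb{N}]$, and write $\mathcal{G}[N]=\mathcal{G}\cap[N]^{<\omega}$. Put $(\mathcal{G})^1_L=\{F\in\mathcal{G}[L]: F\text{ is a cluster point of }\mathcal{G}[F\cup I]\text{ for each }I\in[L]\}$, $(\mathcal{G})^{\xi+1}_L=((\mathcal{G})^{\xi}_L)^1_L$,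 and $(\mathcal{G})^{\xi}_L=\bigcap_{1\le\beta<\xi}(\mathcal{G})^{\beta}_L$ for limit $\xi$. The index $s_L(\mathcal{G})$ is the smallest countable ordinal $\xi\ge1$ with $(\mathcal{G})^\xi_L=\emptyset$. It depends only on $\mathcal{G}\cap[L]^{<\omega}$; in Case 2, $s_L(\mathcal{F}_h)$ for $L\in[M]$ means $s_L(\mathcal{F}_h\cap[M]^{<\omega})$. The complete thin Schreier system $(\mathcal{A}_\xi)_{\xi<\omega_1}$ of families of finite subsets of $\mathbb{N}$: for every non-zero countable limit ordinal $\lambda$ fix a strictly increasing sequence $(\lambda_n)_{n\ge1}$ of successor ordinals smaller than $\lambda$ with $\sup_n\lambda_n=\lambda$. Define recursively (here $p\,\omega^{\alpha}$ denotes the sum of $p$ copies of $\omega^\alpha$): (1) $\mathcal{A}_0=\{\emptyset\}$. (2) $\mathcal{A}_{\zeta+1}=\{\{n\}\cup s_1: n\in\mathbb{N},\ \{n\}<s_1,\ s_1\in\mathcal{A}_\zeta\}$. (3) $\mathcal{A}_{\omega^{\beta+1}}=\{\bigcup_{i=1}^n s_i: n=\min s_1,\ s_1<\dots<s_n,\ s_1,\dots,s_n\in\mathcal{A}_{\omega^\beta}\}$ for $\beta$ a countable ordinal. (4) $\mathcal{A}_{\omega^\lambda}=\{s: s\in\mathcal{A}_{\omega^{\lambda_n}}\text{ with }n=\min s\}$ for $\lambda$ a non-zero countable limit ordinal. (5) If $\xi$ is a limit ordinal with $\omega^\alpha<\xi<\omega^{\alpha+1}$ for some $0<\alpha<\omega_1$,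 write uniquely $\xi=p\,\omega^\alpha+\sum_{i=1}^m p_i\,\omega^{\alpha_i}$ with $m\ge0$, $\alpha>\alpha_1>\dots>\alpha_m>0$, natural numbers $p,p_1,\dots,p_m\ge1$ (either $p>1$, or $p=1$ and $m\ge1$). Then $\mathcal{A}_\xi$ is the family of all $s=s_0\cup\bigcup_{i=1}^m s_i$ with $s_m<\dots<s_1<s_0$, where $s_0=s^0_1\cup\dots\cup s^0_p$ with $s^0_1<\dots<s^0_p$ and all $s^0_j\in\mathcal{A}_{\omega^\alpha}$, and, for $1\le i\le m$, $s_i=s^i_1\cup\dots\cup s^i_{p_i}$ with $s^i_1<\dots<s^i_{p_i}$ and all $s^i_j\in\mathcal{A}_{\omega^{\alpha_i}}$. *)

theory Defs
  imports "HOL-Analysis.Analysis"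
begin

section \<open>Countable ordinals\<close>

text \<open>
  The type of all countable ordinals, i.e. the set \<open>\<omega>\<^sub>1\<close>, realised as the field of the
  initial ordinal \<^term>\<open>cardSuc natLeq\<close>.  Up to isomorphism it is the only well-order that is
  uncountable and has countable proper initial segments, see \<open>countable_lessThan_omega1\<close> and
  \<open>uncountable_omega1\<close> below.
\<close>

unbundle cardinal_syntax

typedef omega1 = "Field (cardSuc natLeq)"
proof -
  have "Field (cardSuc natLeq) \<noteq> {}"
  proof
    assume "Field (cardSuc natLeq) = {}"
    then have "|Field (cardSuc natLeq)| \<le>o |Field natLeq|" by (simp add: card_of_empty)
    then have "cardSuc natLeq \<le>o natLeq"
      using card_of_Field_ordIso[OF natLeq_Card_order]
        card_of_Field_ordIso[OF cardSuc_Card_order[OF natLeq_Card_order]]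
      by (meson ordIso_ordLeq_trans ordIso_symmetric ordLeq_ordIso_trans)
    then show False
      using cardSuc_greater[OF natLeq_Card_order] not_ordLess_ordLeq by blast
  qed
  then show ?thesis by blast
qed

lemma Card_order_cardSuc_natLeq: "Card_order (cardSuc natLeq)"
  by (simp add: cardSuc_Card_order natLeq_Card_order)

lemma Well_order_cardSuc_natLeq: "Well_order (cardSuc natLeq)"
  using Card_order_cardSuc_natLeq card_order_on_well_order_on by blast

instantiation omega1 :: wellorder
begin

definition less_eq_omega1 :: "omega1 \<Rightarrow> omega1 \<Rightarrow> bool" where
  "x \<le> y \<longleftrightarrow> (Rep_omega1 x, Rep_omega1 y) \<in> cardSuc natLeq"

definition less_omega1 :: "omega1 \<Rightarrow> omega1 \<Rightarrow> bool" where
  "x < y \<longleftrightarrow> x \<le> y \<and> x \<noteq> (y :: omega1)"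

instance
proof
  note wo = Well_order_cardSuc_natLeq
  have R: "refl_on (Field (cardSuc natLeq)) (cardSuc natLeq)"
    and T: "trans (cardSuc natLeq)" and A: "antisym (cardSuc natLeq)"
    and tot: "total_on (Field (cardSuc natLeq)) (cardSuc natLeq)"
    and wf: "wf (cardSuc natLeq - Id)"
    using wo unfolding well_order_on_def linear_order_on_def partial_order_on_def preorder_on_def
    by auto
  fix x y z :: omega1
  show refl: "x \<le> x"
    using R Rep_omega1 unfolding less_eq_omega1_def by (meson refl_onD)
  show "x \<le> y \<Longrightarrow> y \<le> z \<Longrightarrow> x \<le> z"
    using T unfolding less_eq_omega1_def by (meson transD)
  show antisym: "x \<le> y \<Longrightarrow> y \<le> x \<Longrightarrow> x = y"
    using A unfolding less_eq_omega1_def by (meson Rep_omega1_inject antisymD)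
  show "(x < y) = (x \<le> y \<and> \<not> y \<le> x)"
    using antisym refl unfolding less_omega1_def by blast
  show "x \<le> y \<or> y \<le> x"
    using tot refl Rep_omega1[of x] Rep_omega1[of y] unfolding less_eq_omega1_def total_on_def
    by (metis Rep_omega1_inject)
  fix P :: "omega1 \<Rightarrow> bool" and a
  assume step: "\<And>x. (\<And>y. y < x \<Longrightarrow> P y) \<Longrightarrow> P x"
  have "wf {(x, y :: omega1). x < y}"
    by (rule wf_subset[OF wf_inv_image[OF wf, of Rep_omega1]])
      (auto simp: less_omega1_def less_eq_omega1_def inv_image_def Rep_omega1_inject)
  then show "P a"
    by (induction a rule: wf_induct_rule) (use step in blast)
qed

end

lemma countable_lessThan_omega1: "countable {..<(\<xi> :: omega1)}"
proof -
  let ?r = "cardSuc natLeq"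
  have "Rep_omega1 ` {..<\<xi>} \<subseteq> underS ?r (Rep_omega1 \<xi>)"
    by (auto simp: underS_def less_omega1_def less_eq_omega1_def Rep_omega1_inject)
  then have "|Rep_omega1 ` {..<\<xi>}| \<le>o |underS ?r (Rep_omega1 \<xi>)|"
    by (rule card_of_mono1)
  also have "|underS ?r (Rep_omega1 \<xi>)| <o ?r"
    by (rule card_of_underS[OF Card_order_cardSuc_natLeq Rep_omega1])
  finally have "|Rep_omega1 ` {..<\<xi>}| \<le>o natLeq"
    using cardSuc_ordLeq_ordLess[OF natLeq_Card_order card_of_Card_order] by blast
  then have "|Rep_omega1 ` {..<\<xi>}| \<le>o |UNIV :: nat set|"
    using card_of_nat ordIso_symmetric ordLeq_ordIso_trans by blast
  then have "countable (Rep_omega1 ` {..<\<xi>})"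
    unfolding card_of_ordLeq[symmetric] countable_def by blast
  then show ?thesis
    by (simp add: countable_image_inj_eq inj_on_def Rep_omega1_inject)
qed

lemma uncountable_omega1: "uncountable (UNIV :: omega1 set)"
proof
  assume "countable (UNIV :: omega1 set)"
  then have "countable (range Rep_omega1)" by simp
  then have "countable (Field (cardSuc natLeq))"
    using type_definition.Rep_range[OF type_definition_omega1] by simp
  then have "|Field (cardSuc natLeq)| \<le>o |UNIV :: nat set|"
    unfolding card_of_ordLeq[symmetric] countable_def by blast
  then have "cardSuc natLeq \<le>o natLeq"
    using card_of_nat card_of_Field_ordIso[OF Card_order_cardSuc_natLeq]
    by (meson ordIso_ordLeq_trans ordIso_symmetric ordLeq_ordIso_trans)
  then show False
    using cardSuc_greater[OF natLeq_Card_order] not_ordLess_ordLeq by blast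
qed

unbundle no cardinal_syntax

lemma bdd_above_countable_omega1:
  assumes "countable (X :: omega1 set)"
  shows "bdd_above X"
proof (rule ccontr)
  assume nb: "\<not> bdd_above X"
  have "UNIV \<subseteq> (\<Union>x\<in>X. {..<x})"
    using nb unfolding bdd_above_def by (auto simp: not_le)
  moreover have "countable (\<Union>x\<in>X. {..<x})"
    using assms countable_lessThan_omega1 by blast
  ultimately show False
    using uncountable_omega1 countable_subset by blast
qed

lemma ex_greater_omega1: "\<exists>y. x < (y :: omega1)"
proof (rule ccontr)
  assume "\<not> ?thesis"
  then have "UNIV \<subseteq> insert x {..<x}" by (auto simp: not_less order_le_less)
  then show False
    using uncountable_omega1 countable_subset[OF _ countable_insert[OF countable_lessThan_omega1]]
    by blast
qed

instantiation omega1 :: conditionally_complete_linorder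
begin

definition inf_omega1 :: "omega1 \<Rightarrow> omega1 \<Rightarrow> omega1" where "inf_omega1 = min"

definition sup_omega1 :: "omega1 \<Rightarrow> omega1 \<Rightarrow> omega1" where "sup_omega1 = max"

definition Inf_omega1 :: "omega1 set \<Rightarrow> omega1" where "Inf (X :: omega1 set) = (LEAST x. x \<in> X)"

definition Sup_omega1 :: "omega1 set \<Rightarrow> omega1" where "Sup (X :: omega1 set) = (LEAST z. \<forall>x\<in>X. x \<le> z)"

instance
proof
  fix x z :: omega1 and X :: "omega1 set"
  show "x \<in> X \<Longrightarrow> bdd_below X \<Longrightarrow> Inf X \<le> x"
    unfolding Inf_omega1_def by (rule Least_le)
  show "X \<noteq> {} \<Longrightarrow> (\<And>x. x \<in> X \<Longrightarrow> z \<le> x) \<Longrightarrow> z \<le> Inf X"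
    unfolding Inf_omega1_def using LeastI[of "\<lambda>x. x \<in> X"] by blast
  show "x \<in> X \<Longrightarrow> bdd_above X \<Longrightarrow> x \<le> Sup X"
    unfolding Sup_omega1_def bdd_above_def using LeastI_ex[of "\<lambda>z. \<forall>x\<in>X. x \<le> z"] by blast
  show "X \<noteq> {} \<Longrightarrow> (\<And>x. x \<in> X \<Longrightarrow> x \<le> z) \<Longrightarrow> Sup X \<le> z"
    unfolding Sup_omega1_def by (rule Least_le) blast
qed (auto simp: inf_omega1_def sup_omega1_def)

end

instantiation omega1 :: zero
begin
definition zero_omega1 :: omega1 where "(0 :: omega1) = (LEAST x. True)"
instance ..
end

lemma zero_le_omega1 [simp]: "0 \<le> (x :: omega1)"
  by (simp add: zero_omega1_def Least_le)

definition osuc :: "omega1 \<Rightarrow> omega1" where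
  "osuc x = (LEAST y. x < y)"

definition is_osuc :: "omega1 \<Rightarrow> bool" where
  "is_osuc x \<longleftrightarrow> (\<exists>y. x = osuc y)"

definition is_olim :: "omega1 \<Rightarrow> bool" where
  "is_olim x \<longleftrightarrow> x \<noteq> 0 \<and> \<not> is_osuc x"

lemma osuc_le_iff: "osuc x \<le> y \<longleftrightarrow> x < y"
proof -
  have "x < osuc x" unfolding osuc_def using ex_greater_omega1 by (rule LeastI_ex)
  then show ?thesis unfolding osuc_def by (metis Least_le order_less_le_trans)
qed

lemma less_osuc [simp]: "x < osuc x"
  using osuc_le_iff by blast

lemma less_osuc_iff: "y < osuc x \<longleftrightarrow> y \<le> x"
  using osuc_le_iff by (meson leD leI less_osuc order_le_less_trans)

lemma osuc_inject [simp]: "osuc x = osuc y \<longleftrightarrow> x = y"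
  by (metis less_osuc less_osuc_iff order_antisym)

lemma osuc_neq_zero [simp]: "osuc x \<noteq> 0" "0 \<noteq> osuc x"
  by (metis less_osuc leD zero_le_omega1)+

lemma not_is_olim [simp]: "\<not> is_olim 0" "\<not> is_olim (osuc x)"
  by (auto simp: is_olim_def is_osuc_def)

lemma omega1_induct [case_names zero osuc lim]:
  assumes "P 0" "\<And>x. P x \<Longrightarrow> P (osuc x)"
    and "\<And>x. is_olim x \<Longrightarrow> (\<And>y. y < x \<Longrightarrow> P y) \<Longrightarrow> P x"
  shows "P (x :: omega1)"
proof (induction x rule: less_induct)
  case (less x)
  then show ?case
    using assms unfolding is_olim_def is_osuc_def by (metis less_osuc)
qed

lemma osuc_less_olim: "is_olim x \<Longrightarrow> y < x \<Longrightarrow> osuc y < x"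
  by (metis is_olim_def is_osuc_def order_le_less osuc_le_iff)

text \<open>
  Transfinite recursion: \<open>z\<close> is the value at 0, \<open>s \<eta> v\<close> the value at \<open>osuc \<eta>\<close> if \<open>v\<close> is the value
  at \<open>\<eta>\<close>, and \<open>l \<xi> f\<close> the value at a limit \<open>\<xi>\<close> if \<open>f\<close> gives the values below \<open>\<xi>\<close>.  Only the
  restriction of \<open>f\<close> to \<open>{..<\<xi>}\<close> is meaningful, whence the congruence assumption in
  \<open>omega1_rec_lim\<close>.
\<close>

definition omega1_rec ::
  "'a \<Rightarrow> (omega1 \<Rightarrow> 'a \<Rightarrow> 'a) \<Rightarrow> (omega1 \<Rightarrow> (omega1 \<Rightarrow> 'a) \<Rightarrow> 'a) \<Rightarrow> omega1 \<Rightarrow> 'a" where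
  "omega1_rec z s l = wfrec {(x, y). x < y} (\<lambda>f \<xi>.
     if \<xi> = 0 then z
     else if is_osuc \<xi> then (let \<eta> = (THE \<eta>. \<xi> = osuc \<eta>) in s \<eta> (f \<eta>))
     else l \<xi> f)"

lemma omega1_rec_zero: "omega1_rec z s l 0 = z"
  unfolding omega1_rec_def by (subst wfrec) (simp_all add: wf)

lemma omega1_rec_osuc: "omega1_rec z s l (osuc \<eta>) = s \<eta> (omega1_rec z s l \<eta>)"
proof -
  have "(THE \<eta>'. osuc \<eta> = osuc \<eta>') = \<eta>" by auto
  moreover have "is_osuc (osuc \<eta>)" by (auto simp: is_osuc_def)
  ultimately show ?thesis
    unfolding omega1_rec_def by (subst wfrec) (simp_all add: wf cut_apply Let_def)
qed

lemma omega1_rec_lim: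
  assumes "is_olim \<xi>"
    and "\<And>f g. (\<And>\<eta>. \<eta> < \<xi> \<Longrightarrow> f \<eta> = g \<eta>) \<Longrightarrow> l \<xi> f = l \<xi> g"
  shows "omega1_rec z s l \<xi> = l \<xi> (omega1_rec z s l)"
proof -
  have "omega1_rec z s l \<xi> = l \<xi> (cut (omega1_rec z s l) {(x, y). x < y} \<xi>)"
    using assms(1) unfolding omega1_rec_def is_olim_def by (subst wfrec) (simp_all add: wf)
  also have "\<dots> = l \<xi> (omega1_rec z s l)"
    by (rule assms(2)) (simp add: cut_apply)
  finally show ?thesis .
qed

instantiation omega1 :: "{one, plus}"
begin

definition one_omega1 :: omega1 where "(1 :: omega1) = osuc 0"

definition plus_omega1 :: "omega1 \<Rightarrow> omega1 \<Rightarrow> omega1" where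
  "x + y = omega1_rec x (\<lambda>_. osuc) (\<lambda>\<xi> f. SUP \<eta>\<in>{..<\<xi>}. f \<eta>) y"

instance ..

end

lemma plus_omega1_zero: "x + 0 = (x :: omega1)"
  by (simp add: plus_omega1_def omega1_rec_zero)

lemma plus_omega1_osuc: "x + osuc y = osuc (x + y)"
  by (simp add: plus_omega1_def omega1_rec_osuc)

lemma plus_omega1_one: "x + 1 = osuc x"
  by (simp add: one_omega1_def plus_omega1_osuc plus_omega1_zero)

lemma plus_omega1_lim: "is_olim \<xi> \<Longrightarrow> x + \<xi> = (SUP \<eta>\<in>{..<\<xi>}. x + \<eta>)"
  unfolding plus_omega1_def
  by (rule omega1_rec_lim) (auto intro!: arg_cong[where f = Sup] image_cong)

lemma Sup_olim: "is_olim \<xi> \<Longrightarrow> Sup {..<\<xi>} = \<xi>"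
proof (rule cSup_eq_non_empty)
  assume lim: "is_olim \<xi>"
  then have "0 < \<xi>" by (simp add: is_olim_def order_less_le)
  then show "{..<\<xi>} \<noteq> {}" by blast
  fix y assume y: "\<And>x. x \<in> {..<\<xi>} \<Longrightarrow> x \<le> y"
  show "\<xi> \<le> y"
  proof (rule ccontr)
    assume "\<not> \<xi> \<le> y"
    then have "osuc y < \<xi>" by (simp add: lim osuc_less_olim)
    then show False using y less_osuc leD by blast
  qed
qed auto

lemma bdd_above_image_lessThan_omega1: "bdd_above (f ` {..<(\<xi> :: omega1)} :: omega1 set)"
  by (rule bdd_above_countable_omega1) (simp add: countable_lessThan_omega1)

lemma plus_omega1_strict_mono:
  assumes "y < z"
  shows "x + y < x + (z :: omega1)"
  using assms
proof (induction z rule: omega1_induct)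
  case (osuc z)
  then show ?case by (auto simp: less_osuc_iff plus_omega1_osuc order_le_less)
next
  case (lim z)
  have "x + y < x + osuc y" by (simp add: plus_omega1_osuc)
  also have "\<dots> \<le> x + z"
    using lim(1,3) osuc_less_olim
    by (auto simp: plus_omega1_lim intro!: cSUP_upper bdd_above_image_lessThan_omega1)
  finally show ?case .
qed (simp add: leD)

lemma less_plus_olim_iff:
  assumes "is_olim z"
  shows "y < x + z \<longleftrightarrow> (\<exists>\<eta><z. y < x + \<eta>)"
proof -
  have "0 < z" using assms by (simp add: is_olim_def order_less_le)
  then have "{..<z} \<noteq> {}" by blast
  then show ?thesis
    using assms by (auto simp: plus_omega1_lim less_cSUP_iff bdd_above_image_lessThan_omega1)
qed

lemma is_olim_plus:
  assumes "is_olim z"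
  shows "is_olim (x + z)"
proof -
  have "x + 0 < x + z"
    using assms by (intro plus_omega1_strict_mono) (simp add: is_olim_def order_less_le)
  then have "x + z \<noteq> 0" by (metis leD zero_le_omega1)
  moreover have "x + z \<noteq> osuc y" for y
  proof
    assume eq: "x + z = osuc y"
    then have "y < x + z" by simp
    then obtain \<eta> where \<eta>: "\<eta> < z" "y < x + \<eta>" using less_plus_olim_iff[OF assms] by blast
    then have "osuc y \<le> x + \<eta>" by (simp add: osuc_le_iff)
    also have "\<dots> < x + z" using \<eta>(1) by (rule plus_omega1_strict_mono)
    finally show False using eq by simp
  qed
  ultimately show ?thesis by (auto simp: is_olim_def is_osuc_def)
qed

instance omega1 :: monoid_add
proof
  fix a b c :: omega1
  show "a + 0 = a" by (rule plus_omega1_zero)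
  show "0 + a = a"
  proof (induction a rule: omega1_induct)
    case (lim x)
    then have "0 + x = Sup {..<x}" by (simp add: plus_omega1_lim)
    then show ?case using lim(1) by (simp add: Sup_olim)
  qed (simp_all add: plus_omega1_zero plus_omega1_osuc)
  show "a + b + c = a + (b + c)"
  proof (induction c rule: omega1_induct)
    case (lim c)
    have "y < a + b + c \<longleftrightarrow> y < a + (b + c)" for y
    proof -
      have "y < a + b + c \<longleftrightarrow> (\<exists>\<eta><c. y < a + (b + \<eta>))"
        using lim by (simp add: less_plus_olim_iff cong: conj_cong)
      also have "\<dots> \<longleftrightarrow> (\<exists>\<theta><b + c. y < a + \<theta>)"
        using plus_omega1_strict_mono less_plus_olim_iff[OF lim(1)] by (meson order_less_trans)
      also have "\<dots> \<longleftrightarrow> y < a + (b + c)"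
        using less_plus_olim_iff[OF is_olim_plus[OF lim(1)]] by blast
      finally show ?thesis .
    qed
    then show ?case by (metis linorder_neqE order_less_irrefl)
  qed (simp_all add: plus_omega1_zero plus_omega1_osuc)
qed

definition omega_pow :: "omega1 \<Rightarrow> omega1" where
  "omega_pow = omega1_rec 1 (\<lambda>_ v. SUP p :: nat. sum_list (replicate p v)) (\<lambda>\<xi> f. SUP \<eta>\<in>{..<\<xi>}. f \<eta>)"

lemma omega_pow_zero: "omega_pow 0 = 1"
  by (simp add: omega_pow_def omega1_rec_zero)

lemma omega_pow_plus_one:
  "omega_pow (\<eta> + 1) = (SUP p :: nat. sum_list (replicate p (omega_pow \<eta>)))"
  by (simp add: omega_pow_def omega1_rec_osuc plus_omega1_one)

lemma omega_pow_lim: "is_olim \<xi> \<Longrightarrow> omega_pow \<xi> = (SUP \<eta>\<in>{..<\<xi>}. omega_pow \<eta>)"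
  unfolding omega_pow_def
  by (rule omega1_rec_lim) (auto intro!: arg_cong[where f = Sup] image_cong)


section \<open>Families of finite sets of positive integers\<close>

text \<open>
  The set \<open>\<nat> = {1, 2, 3, \<dots>}\<close> of the paper is rendered as \<open>{1..} :: nat set\<close>, the set
  of finite subsets of \<open>M\<close> as \<^term>\<open>Fpow M\<close>, and the set \<open>[M]\<close> of its infinite subsets as
  \<open>infsets M\<close>.
\<close>

definition infsets :: "nat set \<Rightarrow> nat set set" where
  "infsets M = {L. L \<subseteq> M \<and> infinite L}"

definition init_seg :: "nat set \<Rightarrow> nat set \<Rightarrow> bool" where
  "init_seg t s \<longleftrightarrow> t \<subseteq> s \<and> (\<forall>x\<in>t. \<forall>y\<in>s. y < x \<longrightarrow> y \<in> t)"

definition star :: "nat set set \<Rightarrow> nat set set" where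
  "star \<G> = {t \<in> Fpow {1..}. \<exists>s\<in>\<G>. init_seg t s} \<union> {{}}"

definition is_tree :: "nat set set \<Rightarrow> bool" where
  "is_tree \<G> \<longleftrightarrow> star \<G> = \<G>"

definition hpart :: "nat set set \<Rightarrow> nat set set" where
  "hpart \<G> = {s \<in> \<G>. \<forall>t. t \<subseteq> s \<and> t \<noteq> {} \<longrightarrow> t \<in> \<G>} \<union> {{}}"

text \<open>
  Characteristic functions.  On \<^typ>\<open>nat \<Rightarrow> bool\<close> the library topology is the product topology
  with discrete factors, i.e. the topology of pointwise convergence.
\<close>

definition charf :: "nat set \<Rightarrow> nat \<Rightarrow> bool" where
  "charf s = (\<lambda>i. i \<in> s)"

definition pw_closed :: "nat set set \<Rightarrow> bool" where
  "pw_closed \<G> \<longleftrightarrow> closed (charf ` \<G>)"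


section \<open>The strong Cantor--Bendixson index\<close>

text \<open>
  Cluster points are accumulation points: every neighbourhood contains a member other than \<open>F\<close>.
\<close>

definition scb_deriv :: "nat set \<Rightarrow> nat set set \<Rightarrow> nat set set" where
  "scb_deriv L \<G> = {F \<in> \<G> \<inter> Fpow L. \<forall>I\<in>infsets L. charf F islimpt charf ` (\<G> \<inter> Fpow (F \<union> I))}"

text \<open>
  The iterated derivatives are meaningful from index 1 on; the value at 0 is chosen such that
  the successor rule yields the first derivative at 1.
\<close>

definition scb :: "nat set \<Rightarrow> nat set set \<Rightarrow> omega1 \<Rightarrow> nat set set" where
  "scb L \<G> = omega1_rec \<G> (\<lambda>_. scb_deriv L) (\<lambda>\<xi> f. \<Inter>\<beta>\<in>{1..<\<xi>}. f \<beta>)"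

definition scb_index :: "nat set \<Rightarrow> nat set set \<Rightarrow> omega1" where
  "scb_index L \<G> = (LEAST \<xi>. 1 \<le> \<xi> \<and> scb L \<G> \<xi> = {})"

lemma scb_zero: "scb L \<G> 0 = \<G>"
  by (simp add: scb_def omega1_rec_zero)

lemma scb_plus_one: "scb L \<G> (\<xi> + 1) = scb_deriv L (scb L \<G> \<xi>)"
  by (simp add: scb_def omega1_rec_osuc plus_omega1_one)

lemma scb_one: "scb L \<G> 1 = scb_deriv L \<G>"
  using scb_plus_one[of L \<G> 0] by (simp add: scb_zero)

lemma scb_lim: "is_olim \<xi> \<Longrightarrow> scb L \<G> \<xi> = (\<Inter>\<beta>\<in>{1..<\<xi>}. scb L \<G> \<beta>)"
  unfolding scb_def by (rule omega1_rec_lim) (auto intro!: arg_cong[where f = Inter] image_cong)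

lemma one_le_omega1_iff: "1 \<le> \<xi> \<longleftrightarrow> \<xi> \<noteq> (0 :: omega1)"
  by (simp add: one_omega1_def osuc_le_iff order_less_le)

lemma scb_antimono: "\<eta> \<le> \<xi> \<Longrightarrow> scb L \<G> \<xi> \<subseteq> scb L \<G> \<eta>"
proof (induction \<xi> arbitrary: \<eta> rule: omega1_induct)
  case zero
  then have "\<eta> = 0" by (meson order_antisym zero_le_omega1)
  then show ?case by simp
next
  case (osuc \<xi>)
  have "scb L \<G> (osuc \<xi>) \<subseteq> scb L \<G> \<xi>"
    by (auto simp: scb_plus_one scb_deriv_def simp flip: plus_omega1_one)
  then show ?case using osuc by (metis less_osuc_iff order_le_less order_refl subset_trans)
next
  case (lim \<xi>)
  have "1 < \<xi>" using lim(1) osuc_less_olim[of \<xi> 0]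
    by (simp add: one_omega1_def is_olim_def order_less_le)
  then have "scb L \<G> \<xi> \<subseteq> scb L \<G> 1" by (auto simp: scb_lim[OF lim(1)])
  moreover have "scb L \<G> 1 \<subseteq> scb L \<G> 0" by (auto simp: scb_one scb_zero scb_deriv_def)
  moreover have "scb L \<G> \<xi> \<subseteq> scb L \<G> \<eta>" if "1 \<le> \<eta>" "\<eta> < \<xi>"
    using that by (auto simp: scb_lim[OF lim(1)])
  ultimately show ?case using lim(3) one_le_omega1_iff by (metis order_le_less order_refl subset_trans)
qed

text \<open>The index is well-defined: the \<open>LEAST\<close> above ranges over a non-empty set.\<close>

lemma scb_index_exists:
  assumes fin: "\<G> \<subseteq> Fpow UNIV" and closed: "pw_closed \<G>" and L: "infinite L"
  shows "\<exists>\<xi>. 1 \<le> \<xi> \<and> scb L \<G> \<xi> = {}"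
proof -
  obtain \<xi> where \<xi>: "scb L \<G> \<xi> = scb L \<G> (osuc \<xi>)"
  proof (rule ccontr)
    assume "\<not> thesis"
    then have "\<exists>F. F \<in> scb L \<G> \<xi> - scb L \<G> (osuc \<xi>)" for \<xi>
      using scb_antimono[of \<xi> "osuc \<xi>" L \<G>] that by (metis DiffI less_osuc order_less_imp_le subset_antisym subsetI)
    then obtain f where f: "f \<xi> \<in> scb L \<G> \<xi> - scb L \<G> (osuc \<xi>)" for \<xi> by metis
    have ne: "f \<xi> \<noteq> f \<eta>" if "\<xi> < \<eta>" for \<xi> \<eta>
      using f[of \<xi>] f[of \<eta>] scb_antimono[of "osuc \<xi>" \<eta> L \<G>] that by (auto simp: osuc_le_iff)
    have "inj f" by (rule injI) (metis ne linorder_neqE)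
    moreover have "f \<xi> \<in> \<G>" for \<xi> using f[of \<xi>] scb_antimono[of 0 \<xi> L \<G>] by (auto simp: scb_zero)
    moreover have "countable \<G>"
      using fin countable_Collect_finite by (auto simp: Fpow_def intro: countable_subset)
    ultimately show False
      using uncountable_omega1 by (metis countable_image_inj_on countable_subset image_subsetI)
  qed
  define X where "X = scb L \<G> \<xi>"
  have X: "scb_deriv L X = X" using \<xi> by (simp add: X_def scb_plus_one flip: plus_omega1_one)
  have XG: "X \<subseteq> \<G>" using scb_antimono[of 0 \<xi> L \<G>] by (simp add: X_def scb_zero)
  have "X = {}"
  proof (rule ccontr)
    assume "X \<noteq> {}"
    have step: "\<exists>F'. F' \<in> X \<and> F \<subset> F'" if "F \<in> X" for F
    proof -
      have "finite F" using that XG fin by (auto simp: Fpow_def)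
      have "charf F islimpt charf ` (X \<inter> Fpow (F \<union> L))"
        using that X L by (auto simp: scb_deriv_def infsets_def)
      moreover have "open {g. \<forall>i\<in>F. g i}"
      proof -
        have "{g. \<forall>i\<in>F. g i} = (\<Inter>i\<in>F. (\<lambda>g :: nat \<Rightarrow> bool. g i) -` {True})" by auto
        moreover have "open ((\<lambda>g :: nat \<Rightarrow> bool. g i) -` {True})" for i
          by (intro open_vimage open_discrete continuous_on_product_coordinates)
        ultimately show ?thesis using \<open>finite F\<close> by (auto)
      qed
      ultimately obtain g where "g \<in> charf ` (X \<inter> Fpow (F \<union> L))" "\<forall>i\<in>F. g i" "g \<noteq> charf F"
        by (auto simp: charf_def elim!: islimptE[where T = "{g. \<forall>i\<in>F. g i}"])
      then show ?thesis by (auto simp: charf_def)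
    qed
    have "\<exists>S. \<forall>n :: nat. S n \<in> X \<and> S n \<subset> S (Suc n)"
      using dependent_nat_choice[of "\<lambda>_ F. F \<in> X" "\<lambda>_ F F'. F \<subset> F'"] step \<open>X \<noteq> {}\<close>
      by (simp add: ex_in_conv)
    then obtain S where "\<forall>n :: nat. S n \<in> X \<and> S n \<subset> S (Suc n)" ..
    then have S: "\<And>n. S n \<in> X" "\<And>n. S n \<subset> S (Suc n)" by simp_all
    define U where "U = (\<Union>n. S n)"
    have mono: "S m \<subseteq> S n" if "m \<le> n" for m n
      by (rule lift_Suc_mono_le[OF _ that]) (use S(2) in blast)
    have "(\<lambda>n. charf (S n) i) \<longlonglongrightarrow> charf U i" for i
    proof -
      have "\<forall>\<^sub>F n in sequentially. charf (S n) i = charf U i"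
      proof (cases "i \<in> U")
        case True
        then obtain m where "i \<in> S m" by (auto simp: U_def)
        then show ?thesis using mono True unfolding eventually_sequentially charf_def by blast
      qed (auto simp: charf_def U_def)
      then show ?thesis by (rule tendsto_eventually)
    qed
    then have "(\<lambda>n. charf (S n)) \<longlonglongrightarrow> charf U"
      using limitin_componentwise[of "\<lambda>_. euclidean" UNIV "\<lambda>n. charf (S n)" "charf U" sequentially]
      by (simp add: euclidean_product_topology)
    then have "charf U \<in> charf ` \<G>"
      using S(1) XG closed unfolding pw_closed_def
      by (intro Lim_in_closed_set[of "charf ` \<G>" "\<lambda>n. charf (S n)" sequentially] always_eventually) auto
    then obtain V where V: "V \<in> \<G>" "charf U = charf V" by blast
    then have "U = V" by (auto simp: charf_def fun_eq_iff)
    with V fin have "finite U" by (auto simp: Fpow_def)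
    have "n \<le> card (S n)" for n
    proof (induction n)
      case (Suc n)
      have "finite (S (Suc n))" using S(1) XG fin by (auto simp: Fpow_def)
      then have "card (S n) < card (S (Suc n))" using S(2) by (rule psubset_card_mono)
      then show ?case using Suc by simp
    qed simp
    moreover have "card (S n) \<le> card U" for n
      using \<open>finite U\<close> by (intro card_mono) (auto simp: U_def)
    ultimately show False by (metis le_trans not_less_eq_eq)
  qed
  then have "scb L \<G> (osuc \<xi>) = {}" using \<xi> X_def by simp
  then show ?thesis by (metis one_le_omega1_iff osuc_neq_zero(1))
qed

text \<open>
  \<open>\<zeta>\<^sup>\<F>\<^sub>M\<close> is the supremum of this set of indices.  In \<^typ>\<open>omega1\<close> a supremum exists, i.e. is
  a countable ordinal, iff the set is bounded above.
\<close>

definition tree_indices :: "nat set set \<Rightarrow> nat set \<Rightarrow> omega1 set" where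
  "tree_indices \<F> M = (\<lambda>L. scb_index L (hpart \<F> \<inter> Fpow M)) ` infsets M"

definition tree_index :: "nat set set \<Rightarrow> nat set \<Rightarrow> omega1" where
  "tree_index \<F> M = Sup (tree_indices \<F> M)"


section \<open>The complete thin Schreier system\<close>

definition fundamental_sequences :: "(omega1 \<Rightarrow> nat \<Rightarrow> omega1) \<Rightarrow> bool" where
  "fundamental_sequences fs \<longleftrightarrow> (\<forall>\<mu>. is_olim \<mu> \<longrightarrow>
     strict_mono_on {1..} (fs \<mu>) \<and>
     (\<forall>n\<ge>1. is_osuc (fs \<mu> n) \<and> fs \<mu> n < \<mu>) \<and>
     (SUP n\<in>{1..}. fs \<mu> n) = \<mu>)"

text \<open>
  The relation \<open>s < t\<close>; a comparison with \<open>{}\<close> counts as true.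
\<close>

definition block_less :: "nat set \<Rightarrow> nat set \<Rightarrow> bool" where
  "block_less s t \<longleftrightarrow> s = {} \<or> t = {} \<or> Max s < Min t"

text \<open>
  Every countable ordinal is of exactly one of the five forms below and determines the
  parameters of that form, so that the rules amount to a definition by recursion.  In rule
  \<open>cnf\<close>, the list \<open>cs = [(\<alpha>, p), (\<alpha>\<^sub>1, p\<^sub>1), \<dots>, (\<alpha>\<^sub>m, p\<^sub>m)]\<close> is the Cantor normal form
  of the index, and \<open>tss ! i\<close> lists the \<open>p\<^sub>i\<close> blocks whose union is \<open>s\<^sub>i\<close>; the blocks within one
  \<open>s\<^sub>i\<close> are increasing, whereas the \<open>s\<^sub>i\<close> themselves are decreasing in \<open>i\<close>.
\<close>

inductive in_schreier :: "(omega1 \<Rightarrow> nat \<Rightarrow> omega1) \<Rightarrow> omega1 \<Rightarrow> nat set \<Rightarrow> bool"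
  for fs :: "omega1 \<Rightarrow> nat \<Rightarrow> omega1" where
  zero: "in_schreier fs 0 {}"
| plus_one: "in_schreier fs (\<zeta> + 1) ({n} \<union> s)"
    if "n \<ge> 1" "block_less {n} s" "in_schreier fs \<zeta> s"
| pow_plus_one: "in_schreier fs (omega_pow (\<beta> + 1)) (\<Union>(set ss))"
    if "ss \<noteq> []" "length ss = Min (hd ss)" "sorted_wrt block_less ss"
      "\<forall>s\<in>set ss. in_schreier fs (omega_pow \<beta>) s"
| pow_lim: "in_schreier fs (omega_pow \<mu>) s"
    if "is_olim \<mu>" "in_schreier fs (omega_pow (fs \<mu> (Min s))) s"
| cnf: "in_schreier fs (\<Sum>(\<alpha>, p)\<leftarrow>cs. sum_list (replicate p (omega_pow \<alpha>))) (\<Union>ts\<in>set tss. \<Union>(set ts))"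
    if "cs \<noteq> []" "length cs \<ge> 2 \<or> snd (hd cs) \<ge> 2"
      "sorted_wrt (\<lambda>c d. fst c > fst d) cs" "\<forall>(\<alpha>, p)\<in>set cs. \<alpha> > 0 \<and> p \<ge> 1"
      "length tss = length cs"
      "\<forall>i<length cs. length (tss ! i) = snd (cs ! i) \<and> sorted_wrt block_less (tss ! i) \<and>
         (\<forall>t\<in>set (tss ! i). in_schreier fs (omega_pow (fst (cs ! i))) t)"
      "sorted_wrt (\<lambda>s s'. block_less s' s) (map (\<lambda>ts. \<Union>(set ts)) tss)"

definition schreier :: "(omega1 \<Rightarrow> nat \<Rightarrow> omega1) \<Rightarrow> omega1 \<Rightarrow> nat set set" where
  "schreier fs \<xi> = {s. in_schreier fs \<xi> s}"

end

theory Submission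
  imports Defs
begin

text \<open>
  Write \<open>A\<^sub>\<xi>\<close> for the Schreier family of index \<open>\<xi>\<close>. By Cantor normal forms, for \<open>\<xi> \<noteq> 0\<close> the tails
  \<open>s\<close> of the members \<open>{n} \<union> s\<close> of \<open>A\<^sub>\<xi>\<close> with minimum \<open>n\<close> form, above \<open>n\<close>, a Schreier family of some
  index \<open>\<xi>\<^sub>n < \<xi>\<close>, and every \<open>\<eta> < \<xi>\<close> satisfies \<open>\<eta> \<le> \<xi>\<^sub>n\<close> for almost all \<open>n\<close>. All
  inductions on \<open>\<xi>\<close> go through this recursion, combined with diagonalization over \<open>n\<close>: each
  \<open>A\<^sub>\<xi>\<close> has the Ramsey property, and every infinite set has an initial segment in it.

  For a hereditary family \<open>G\<close>, a set \<open>F\<close> survives one strong derivation on \<open>L\<close> iff \<open>F \<union> {n} \<in> G\<close> for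
  almost all \<open>n \<in> L\<close>. If \<open>\<emptyset>\<close> survives \<open>\<xi> + 1\<close> derivations, diagonalization yields \<open>K\<close> such that all
  members of \<open>A\<^sub>\<xi>\<close> inside \<open>K\<close> belong to \<open>G\<close>. Conversely, if they do, \<open>\<emptyset>\<close> survives \<open>\<xi>\<close> derivations on
  \<open>K\<close>; for a tree \<open>\<F>\<close>, a second use of Ramsey's theorem passes from \<open>\<F>\<close> to its hereditary part.
\<close>

section \<open>Cantor normal forms\<close>

lemma plus_omega1_mono_right: "y \<le> z \<Longrightarrow> x + y \<le> x + (z :: omega1)"
  by (metis order_le_less plus_omega1_strict_mono)

lemma plus_omega1_mono_left: "x \<le> y \<Longrightarrow> x + z \<le> y + (z :: omega1)"
proof (induction z rule: omega1_induct)
  case (lim z)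
  then have "x + \<eta> \<le> y + z" if "\<eta> < z" for \<eta>
    using that by (meson order_trans order_less_imp_le plus_omega1_strict_mono)
  then show ?case
    using lim.hyps(1) less_plus_olim_iff by (meson leD leI order_less_le_trans)
qed (simp_all add: plus_omega1_osuc osuc_le_iff less_osuc_iff)

lemma plus_omega1_left_cancel [simp]: "x + y = x + z \<longleftrightarrow> y = (z :: omega1)"
  by (metis linorder_neqE order_less_irrefl plus_omega1_strict_mono)

lemma plus_omega1_less_cancel [simp]: "x + y < x + z \<longleftrightarrow> y < (z :: omega1)"
  by (meson leD leI plus_omega1_mono_right plus_omega1_strict_mono)

lemma le_plus_omega1_left: "x \<le> x + (y :: omega1)"
  using plus_omega1_mono_right[of 0 y x] by simp

lemma le_plus_omega1_right: "y \<le> x + (y :: omega1)"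
  using plus_omega1_mono_left[of 0 x y] by simp

lemma is_olim_iff: "is_olim x \<longleftrightarrow> x \<noteq> 0 \<and> (\<forall>y<x. osuc y < x)"
  by (metis is_olim_def is_osuc_def less_osuc order_less_irrefl osuc_less_olim)

text \<open>The least \<open>z\<close> with \<open>y \<le> x + z\<close> gives equality. All smaller
  \<open>w\<close> have \<open>x + w < y\<close>, so continuity of addition handles a limit
  \<open>z\<close>, and for \<open>z = osuc w\<close> the value \<open>x + z\<close> is the
  successor of something below \<open>y\<close>.\<close>

lemma ex_plus_omega1:
  assumes "x \<le> (y :: omega1)"
  shows "\<exists>z. y = x + z"
proof -
  define z where "z = (LEAST z. y \<le> x + z)"
  have z: "y \<le> x + z"
    unfolding z_def by (rule LeastI[of _ y]) (rule le_plus_omega1_right)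
  have less: "x + w < y" if "w < z" for w
    using not_less_Least[of w "\<lambda>z. y \<le> x + z"] that by (simp add: z_def not_le)
  have "x + z \<le> y"
  proof (cases "z = 0 \<or> is_olim z")
    case True
    then show ?thesis
      using assms less less_plus_olim_iff[of z y x] by (metis add_0_right leI order_less_asym)
  next
    case False
    then obtain w where "z = osuc w" by (auto simp: is_olim_def is_osuc_def)
    then show ?thesis using less[of w] by (simp add: plus_omega1_osuc osuc_le_iff)
  qed
  with z show ?thesis by (metis order_antisym)
qed

section \<open>Powers of \<omega> and their finite multiples\<close>

abbreviation omega_mult :: "nat \<Rightarrow> omega1 \<Rightarrow> omega1" where
  "omega_mult p \<beta> \<equiv> sum_list (replicate p (omega_pow \<beta>))"

lemma omega_pow_osuc: "omega_pow (osuc \<eta>) = (SUP p. omega_mult p \<eta>)"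
  using omega_pow_plus_one[of \<eta>] by (simp add: plus_omega1_one)

lemma less_omega_pow_osuc_iff: "\<eta> < omega_pow (osuc \<beta>) \<longleftrightarrow> (\<exists>p. \<eta> < omega_mult p \<beta>)"
  unfolding omega_pow_osuc by (subst less_cSUP_iff) (auto intro: bdd_above_countable_omega1)

lemma less_omega_pow_olim_iff:
  assumes "is_olim \<mu>"
  shows "\<eta> < omega_pow \<mu> \<longleftrightarrow> (\<exists>\<gamma><\<mu>. \<eta> < omega_pow \<gamma>)"
proof -
  have "0 < \<mu>" using assms by (simp add: is_olim_def order_less_le)
  then have "{..<\<mu>} \<noteq> {}" by blast
  then show ?thesis
    unfolding omega_pow_lim[OF assms]
    by (subst less_cSUP_iff) (auto intro: bdd_above_image_lessThan_omega1)
qed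

lemma omega_pow_pos [simp]: "0 < omega_pow \<alpha>"
proof (induction \<alpha> rule: omega1_induct)
  case zero
  then show ?case by (simp add: omega_pow_zero one_omega1_def)
next
  case (osuc \<alpha>)
  then show ?case unfolding less_omega_pow_osuc_iff by (intro exI[of _ 1]) simp
next
  case (lim \<alpha>)
  then show ?case by (metis is_olim_iff less_omega_pow_olim_iff less_osuc order_less_le zero_le_omega1)
qed

lemma omega_pow_neq_zero [simp]: "omega_pow \<alpha> \<noteq> 0" "0 \<noteq> omega_pow \<alpha>"
  using omega_pow_pos[of \<alpha>] by (metis order_less_irrefl)+

text \<open>The list sum puts a new summand on the left. Since ordinal addition is not commutative,
  it has to be moved to the right, where addition is strictly monotone.\<close>

lemma omega_mult_Suc: "omega_mult (Suc p) \<beta> = omega_mult p \<beta> + omega_pow \<beta>"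
  by (induction p) (simp_all flip: add.assoc)

lemma omega_mult_less_Suc: "omega_mult p \<beta> < omega_mult (Suc p) \<beta>"
  using plus_omega1_strict_mono[OF omega_pow_pos, of "omega_mult p \<beta>" \<beta>]
  by (simp only: omega_mult_Suc add_0_right)

lemma omega_mult_less: "omega_mult p \<beta> < omega_pow (osuc \<beta>)"
  using omega_mult_less_Suc less_omega_pow_osuc_iff by blast

lemma omega_mult_mono: "p \<le> q \<Longrightarrow> omega_mult p \<beta> \<le> omega_mult q \<beta>"
  by (rule lift_Suc_mono_le[of "\<lambda>p. omega_mult p \<beta>", OF order_less_imp_le[OF omega_mult_less_Suc]])

lemma omega_pow_strict_mono: "\<alpha> < \<beta> \<Longrightarrow> omega_pow \<alpha> < omega_pow \<beta>"
proof (induction \<beta> rule: omega1_induct)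
  case zero
  then show ?case by (simp add: leD)
next
  case (osuc \<beta>)
  have "omega_pow \<beta> < omega_pow (osuc \<beta>)" using omega_mult_less[of 1 \<beta>] by simp
  with osuc show ?case by (metis less_osuc_iff order_le_less order_less_trans)
next
  case (lim \<beta>)
  then show ?case by (metis less_omega_pow_olim_iff less_osuc osuc_less_olim)
qed

lemma omega_pow_mono: "\<alpha> \<le> \<beta> \<Longrightarrow> omega_pow \<alpha> \<le> omega_pow \<beta>"
  by (metis omega_pow_strict_mono order_le_less)

lemma is_olim_omega_pow:
  assumes "0 < \<alpha>"
  shows "is_olim (omega_pow \<alpha>)"
proof -
  have "osuc y < omega_pow \<alpha>" if "y < omega_pow \<alpha>" for y
  proof (cases "is_olim \<alpha>")
    case True
    with that show ?thesis
      by (metis less_omega_pow_olim_iff omega_pow_strict_mono order_le_less_trans osuc_le_iff)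
  next
    case False
    with assms obtain \<beta> where \<beta>: "\<alpha> = osuc \<beta>" by (auto simp: is_olim_def is_osuc_def)
    with that show ?thesis
      by (metis less_omega_pow_osuc_iff omega_mult_less order_le_less_trans osuc_le_iff)
  qed
  then show ?thesis by (simp add: is_olim_iff)
qed

text \<open>Below a successor power both summands lie under finite multiples of the previous power,
  and these add up to a finite multiple. Below a limit power both lie under a common
  \<open>omega_pow \<epsilon>\<close>, whose double is less than
  \<open>omega_pow (osuc \<epsilon>)\<close>.\<close>

lemma omega_pow_indecomposable:
  assumes "x < omega_pow \<alpha>" "y < omega_pow \<alpha>"
  shows "x + y < omega_pow \<alpha>"
proof -
  have less: "x + y < a + b" if "x < a" "y < b" for a b
    using that by (meson order_le_less_trans order_less_imp_le plus_omega1_mono_left plus_omega1_strict_mono)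
  consider "\<alpha> = 0" | \<beta> where "\<alpha> = osuc \<beta>" | "is_olim \<alpha>"
    by (auto simp: is_olim_def is_osuc_def)
  then show ?thesis
  proof cases
    case 1
    with assms show ?thesis
      by (metis add_0 less_osuc_iff omega_pow_zero one_omega1_def order_antisym zero_le_omega1)
  next
    case 2
    with assms obtain p q where "x < omega_mult p \<beta>" "y < omega_mult q \<beta>"
      by (auto simp: less_omega_pow_osuc_iff)
    then have "x + y < omega_mult (p + q) \<beta>" by (metis less replicate_add sum_list_append)
    with 2 show ?thesis by (metis less_omega_pow_osuc_iff)
  next
    case 3
    with assms obtain \<gamma> \<delta> where gd: "\<gamma> < \<alpha>" "x < omega_pow \<gamma>" "\<delta> < \<alpha>" "y < omega_pow \<delta>"
      by (auto simp: less_omega_pow_olim_iff)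
    define \<epsilon> where "\<epsilon> = max \<gamma> \<delta>"
    have "\<epsilon> < \<alpha>" "x < omega_pow \<epsilon>" "y < omega_pow \<epsilon>"
      using gd omega_pow_mono[of \<gamma> \<epsilon>] omega_pow_mono[of \<delta> \<epsilon>] by (auto simp: \<epsilon>_def)
    then have "x + y < omega_pow \<epsilon> + omega_pow \<epsilon>" by (intro less)
    also have "\<dots> = omega_mult 2 \<epsilon>" by (simp add: numeral_2_eq_2)
    also have "\<dots> < omega_pow (osuc \<epsilon>)" by (rule omega_mult_less)
    also have "\<dots> \<le> omega_pow \<alpha>" using \<open>\<epsilon> < \<alpha>\<close> by (simp add: omega_pow_mono osuc_le_iff)
    finally show ?thesis .
  qed
qed

section \<open>Existence and uniqueness of Cantor normal forms\<close>

text \<open>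
  A Cantor normal form is given by its sorted list of exponents, repeated according to their
  multiplicities; the head is the lowest exponent, whose block comes first in the members of
  the Schreier families.
\<close>

primrec cnf_val :: "omega1 list \<Rightarrow> omega1" where
  "cnf_val [] = 0"
| "cnf_val (\<alpha> # l) = cnf_val l + omega_pow \<alpha>"

lemma cnf_val_append: "cnf_val (xs @ ys) = cnf_val ys + cnf_val xs"
  by (induction xs) (simp_all add: add.assoc)

lemma cnf_val_replicate: "cnf_val (replicate p \<beta>) = omega_mult p \<beta>"
proof (induction p)
  case (Suc p)
  then show ?case unfolding omega_mult_Suc by simp
qed simp

lemma cnf_val_less: "(\<And>x. x \<in> set l \<Longrightarrow> x < \<alpha>) \<Longrightarrow> cnf_val l < omega_pow \<alpha>"
  by (induction l) (simp_all add: omega_pow_indecomposable omega_pow_strict_mono)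

lemma omega_pow_le_cnf_val: "x \<in> set l \<Longrightarrow> omega_pow x \<le> cnf_val l"
  by (induction l) (auto intro: le_plus_omega1_right order_trans[OF _ le_plus_omega1_left])

lemma cnf_val_eq_zero_iff [simp]: "cnf_val l = 0 \<longleftrightarrow> l = []" "0 = cnf_val l \<longleftrightarrow> l = []"
proof -
  show "cnf_val l = 0 \<longleftrightarrow> l = []"
    using omega_pow_le_cnf_val[of "hd l" l] omega_pow_pos[of "hd l"]
    by (cases l) (auto simp del: omega_pow_pos dest: leD)
  then show "0 = cnf_val l \<longleftrightarrow> l = []" by metis
qed

text \<open>The last entry is the leading exponent. If one list had the larger last entry, a single
  power with this exponent would exceed the whole value of the other list. Equal leading powers
  cancel on the left.\<close>

lemma cnf_val_inject:
  assumes "sorted l" "sorted l'" "cnf_val l = cnf_val l'"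
  shows "l = l'"
  using assms
proof (induction l arbitrary: l' rule: rev_induct)
  case (snoc a l)
  then obtain b l'' where l': "l' = l'' @ [b]" by (cases l' rule: rev_cases) auto
  have le: "x \<le> y" if "sorted (xs @ [x])" "sorted (ys @ [y])"
      "cnf_val (xs @ [x]) = cnf_val (ys @ [y])" for x y xs ys
  proof (rule ccontr)
    assume "\<not> x \<le> y"
    then have "cnf_val (ys @ [y]) < omega_pow x"
      using that(2) by (intro cnf_val_less) (auto simp: sorted_append intro: order_le_less_trans)
    then show False using omega_pow_le_cnf_val[of x "xs @ [x]"] that(3) by auto
  qed
  have "a = b" using le[of l a l'' b] le[of l'' b l a] snoc.prems l' by simp
  moreover have "l = l''"
    using snoc.prems snoc.IH[of l''] l' \<open>a = b\<close> by (auto simp: sorted_append cnf_val_append)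
  ultimately show ?case by (simp add: l')
qed simp

text \<open>Division by the leading power: subtract the largest power of \<omega> below or equal to
  \<xi> from the left and apply induction to the remainder.\<close>

lemma cnf_exists: "\<exists>l. sorted l \<and> cnf_val l = \<xi>"
proof (induction \<xi> rule: less_induct)
  case (less \<xi>)
  show ?case
  proof (cases "\<xi> = 0")
    case False
    \<comment> \<open>This makes \<open>osuc \<xi>\<close> a witness that some power of \<omega>
      exceeds \<xi>.\<close>
    have self: "\<alpha> \<le> omega_pow \<alpha>" for \<alpha>
    proof (induction \<alpha> rule: less_induct)
      case (less \<alpha>)
      show ?case
      proof (rule ccontr)
        assume "\<not> \<alpha> \<le> omega_pow \<alpha>"
        then have lt: "omega_pow \<alpha> < \<alpha>" by simp
        show False using less[OF lt] omega_pow_strict_mono[OF lt] by simp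
      qed
    qed
    \<comment> \<open>The least such exponent is neither 0, as \<xi> is positive, nor a limit, by
      continuity. Its predecessor \<open>b\<close> is the leading exponent.\<close>
    define a where "a = (LEAST a. \<xi> < omega_pow a)"
    have a: "\<xi> < omega_pow a"
      unfolding a_def by (rule LeastI[of _ "osuc \<xi>"]) (use self[of "osuc \<xi>"] osuc_le_iff in blast)
    have below: "omega_pow b \<le> \<xi>" if "b < a" for b
      using not_less_Least[of b "\<lambda>a. \<xi> < omega_pow a"] that by (simp add: a_def not_less)
    have "a \<noteq> 0"
      using a False by (metis less_osuc_iff omega_pow_zero one_omega1_def order_antisym zero_le_omega1)
    moreover have "\<not> is_olim a" using a below less_omega_pow_olim_iff by (meson leD)
    ultimately obtain b where b: "a = osuc b" by (auto simp: is_olim_def is_osuc_def)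
    obtain \<rho> where \<rho>: "\<xi> = omega_pow b + \<rho>" using ex_plus_omega1 below b by (metis less_osuc)
    \<comment> \<open>Otherwise \<xi> would absorb every finite multiple of
      \<open>omega_pow b\<close> on the left and hence could not lie below
      \<open>omega_pow (osuc b)\<close>.\<close>
    have "\<rho> \<noteq> \<xi>"
    proof
      assume eq: "\<rho> = \<xi>"
      have absorb: "omega_mult p b + \<xi> = \<xi>" for p
        by (induction p) (simp_all add: add.assoc flip: \<rho>[unfolded eq])
      obtain p where "\<xi> < omega_mult p b" using a b less_omega_pow_osuc_iff by blast
      then show False using absorb[of p] le_plus_omega1_left[of "omega_mult p b" \<xi>] by simp
    qed
    then have "\<rho> < \<xi>" using \<rho> le_plus_omega1_right[of \<rho>] by (simp add: order_less_le)
    with less obtain l where l: "sorted l" "cnf_val l = \<rho>" by blast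
    have "x \<le> b" if "x \<in> set l" for x
    proof (rule ccontr)
      assume "\<not> x \<le> b"
      then have "omega_pow a \<le> omega_pow x" using b by (simp add: omega_pow_mono osuc_le_iff)
      also have "\<dots> \<le> \<rho>" using omega_pow_le_cnf_val[OF that] l by simp
      finally show False using a \<open>\<rho> < \<xi>\<close> by simp
    qed
    then have "sorted (l @ [b])" using l by (simp add: sorted_append)
    moreover have "cnf_val (l @ [b]) = \<xi>" using l \<rho> by (simp add: cnf_val_append)
    ultimately show ?thesis by blast
  qed (auto intro: exI[of _ "[]"])
qed

section \<open>Schreier families\<close>

definition join :: "nat set set \<Rightarrow> nat set set \<Rightarrow> nat set set" where
  "join X Y = {s \<union> t | s t. s \<in> X \<and> t \<in> Y \<and> (\<forall>x\<in>s. \<forall>y\<in>t. x < y)}"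

lemma joinI: "s \<in> X \<Longrightarrow> t \<in> Y \<Longrightarrow> \<forall>x\<in>s. \<forall>y\<in>t. x < y \<Longrightarrow> s \<union> t \<in> join X Y"
  by (auto simp: join_def)

lemma join_assoc: "join (join X Y) Z = join X (join Y Z)"
proof (intro equalityI subsetI)
  fix r assume "r \<in> join (join X Y) Z"
  then obtain s t u where r: "r = (s \<union> t) \<union> u" and "s \<in> X" "t \<in> Y" "u \<in> Z"
    and st: "\<forall>x\<in>s. \<forall>y\<in>t. x < y" and stu: "\<forall>x\<in>s \<union> t. \<forall>y\<in>u. x < y"
    by (auto simp: join_def)
  moreover have "t \<union> u \<in> join Y Z"
    using \<open>t \<in> Y\<close> \<open>u \<in> Z\<close> stu unfolding join_def by blast
  moreover have "\<forall>x\<in>s. \<forall>y\<in>t \<union> u. x < y" using st stu by blast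
  ultimately show "r \<in> join X (join Y Z)" using joinI[of s X "t \<union> u" "join Y Z"] by (simp add: Un_assoc)
next
  fix r assume "r \<in> join X (join Y Z)"
  then obtain s t u where r: "r = s \<union> (t \<union> u)" and "s \<in> X" "t \<in> Y" "u \<in> Z"
    and tu: "\<forall>x\<in>t. \<forall>y\<in>u. x < y" and stu: "\<forall>x\<in>s. \<forall>y\<in>t \<union> u. x < y"
    by (auto simp: join_def)
  moreover have "s \<union> t \<in> join X Y"
    using \<open>s \<in> X\<close> \<open>t \<in> Y\<close> stu unfolding join_def by blast
  moreover have "\<forall>x\<in>s \<union> t. \<forall>y\<in>u. x < y" using tu stu by blast
  ultimately show "r \<in> join (join X Y) Z" using joinI[of "s \<union> t" "join X Y" u Z] by (simp add: Un_assoc)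
qed

lemma join_empty_left [simp]: "join {{}} Y = Y"
  by (auto simp: join_def)

lemma join_empty_right [simp]: "join X {{}} = X"
  by (auto simp: join_def)

text \<open>The minimum of a concatenation belongs to its first block, because that block is
  nonempty. Removing the minimum therefore changes only the left factor.\<close>

lemma join_insert_iff:
  assumes ne: "\<And>u. u \<in> X \<Longrightarrow> u \<noteq> {}"
    and XX': "\<And>u. u \<subseteq> {n<..} \<Longrightarrow> insert n u \<in> X \<longleftrightarrow> u \<in> X'"
    and s: "s \<subseteq> {n<..}"
  shows "insert n s \<in> join X Y \<longleftrightarrow> s \<in> join X' Y"
proof
  assume "insert n s \<in> join X Y"
  then obtain u t where ut: "insert n s = u \<union> t" "u \<in> X" "t \<in> Y" "\<forall>x\<in>u. \<forall>y\<in>t. x < y"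
    by (auto simp: join_def)
  obtain x where x: "x \<in> u" using ne ut by blast
  have "n \<le> x" using x ut(1) s by (metis UnCI greaterThan_iff insertE order_less_imp_le order_refl subsetD)
  have "n \<notin> t" using x \<open>n \<le> x\<close> ut(4) by (meson leD)
  then have "n \<in> u" using ut(1) by blast
  have "n \<notin> s" using s by auto
  define u' where "u' = u - {n}"
  have u: "u = insert n u'" using \<open>n \<in> u\<close> by (auto simp: u'_def)
  have s': "s = u' \<union> t" using ut(1) \<open>n \<notin> t\<close> \<open>n \<notin> s\<close> by (auto simp: u'_def)
  then have "u' \<in> X'" using XX'[of u'] s ut(2) u by auto
  then show "s \<in> join X' Y" using s' ut u unfolding join_def by blast
next
  assume "s \<in> join X' Y"
  then obtain u t where ut: "s = u \<union> t" "u \<in> X'" "t \<in> Y" "\<forall>x\<in>u. \<forall>y\<in>t. x < y"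
    by (auto simp: join_def)
  then have "insert n u \<in> X" using XX'[of u] s by auto
  moreover have "\<forall>x\<in>insert n u. \<forall>y\<in>t. x < y" using ut s by auto
  moreover have "insert n s = insert n u \<union> t" using ut(1) by simp
  ultimately show "insert n s \<in> join X Y" using ut(3) unfolding join_def by blast
qed

lemma block_less_iff:
  assumes "finite s" "finite t"
  shows "block_less s t \<longleftrightarrow> (\<forall>x\<in>s. \<forall>y\<in>t. x < y)"
  using assms by (cases "s = {} \<or> t = {}") (auto simp: block_less_def)

lemma in_schreier_finite: "in_schreier fs \<xi> s \<Longrightarrow> finite s \<and> s \<subseteq> {1..}"
proof (induction rule: in_schreier.induct)
  case (cnf cs tss)
  have "finite t \<and> t \<subseteq> {1..}" if "ts \<in> set tss" "t \<in> set ts" for ts t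
    using cnf.IH cnf.hyps(5) that by (metis in_set_conv_nth)
  then show ?case by blast
qed auto

lemma in_schreier_nonempty: "in_schreier fs \<xi> s \<Longrightarrow> \<xi> \<noteq> 0 \<Longrightarrow> s \<noteq> {}"
proof (induction rule: in_schreier.induct)
  case (pow_plus_one ss \<beta>)
  then show ?case by (cases ss) auto
next
  case (cnf cs tss)
  have "tss \<noteq> []" using cnf by auto
  then have "tss ! 0 \<in> set tss" by simp
  have 0: "0 < length cs" using cnf by simp
  have "cs ! 0 \<in> set cs" using 0 by simp
  then have "snd (cs ! 0) \<ge> 1" using cnf.hyps(4) by (auto simp: case_prod_beta)
  then have "length (tss ! 0) \<ge> 1" using cnf.IH 0 by auto
  then obtain t where "t \<in> set (tss ! 0)" by (cases "tss ! 0") auto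
  then have "t \<noteq> {}" using cnf.IH 0 by auto
  then show ?case using \<open>t \<in> set (tss ! 0)\<close> \<open>tss ! 0 \<in> set tss\<close> by blast
qed auto

lemma schreier_finite: "s \<in> schreier fs \<xi> \<Longrightarrow> finite s"
  and schreier_pos: "s \<in> schreier fs \<xi> \<Longrightarrow> s \<subseteq> {1..}"
  and schreier_nonempty: "s \<in> schreier fs \<xi> \<Longrightarrow> \<xi> \<noteq> 0 \<Longrightarrow> s \<noteq> {}"
  using in_schreier_finite in_schreier_nonempty by (auto simp: schreier_def)

section \<open>The families read off from normal forms, and the inductive rules\<close>

primrec cnf_family :: "(omega1 \<Rightarrow> nat \<Rightarrow> omega1) \<Rightarrow> omega1 list \<Rightarrow> nat set set" where
  "cnf_family fs [] = {{}}"
| "cnf_family fs (\<alpha> # l) = join (schreier fs (omega_pow \<alpha>)) (cnf_family fs l)"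

lemma cnf_family_append: "cnf_family fs (xs @ ys) = join (cnf_family fs xs) (cnf_family fs ys)"
  by (induction xs) (simp_all add: join_assoc)

lemma cnf_family_replicate:
  "cnf_family fs (replicate p \<alpha>) =
    {\<Union>(set ts) | ts. length ts = p \<and> sorted_wrt block_less ts \<and> (\<forall>t\<in>set ts. t \<in> schreier fs (omega_pow \<alpha>))}"
proof (induction p)
  case (Suc p)
  let ?A = "schreier fs (omega_pow \<alpha>)"
  have eq: "(\<forall>t'\<in>set ts. block_less t t') \<longleftrightarrow> (\<forall>x\<in>t. \<forall>y\<in>\<Union>(set ts). x < y)"
    if "t \<in> ?A" "\<forall>t\<in>set ts. t \<in> ?A" for t ts
  proof -
    have "block_less t t' \<longleftrightarrow> (\<forall>x\<in>t. \<forall>y\<in>t'. x < y)" if "t' \<in> set ts" for t'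
      using that \<open>t \<in> ?A\<close> \<open>\<forall>t\<in>set ts. t \<in> ?A\<close> by (intro block_less_iff) (auto intro: schreier_finite)
    then show ?thesis by auto
  qed
  show ?case
  proof (intro equalityI subsetI)
    fix s assume "s \<in> cnf_family fs (replicate (Suc p) \<alpha>)"
    then obtain t ts where s: "s = t \<union> \<Union>(set ts)" "t \<in> ?A" "length ts = p" "sorted_wrt block_less ts"
      "\<forall>t\<in>set ts. t \<in> ?A" "\<forall>x\<in>t. \<forall>y\<in>\<Union>(set ts). x < y"
      by (auto simp: Suc join_def)
    then show "s \<in> {\<Union>(set ts) | ts. length ts = Suc p \<and> sorted_wrt block_less ts \<and> (\<forall>t\<in>set ts. t \<in> ?A)}"
      using eq[of t ts] by (intro CollectI exI[of _ "t # ts"]) auto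
  next
    fix s assume "s \<in> {\<Union>(set ts) | ts. length ts = Suc p \<and> sorted_wrt block_less ts \<and> (\<forall>t\<in>set ts. t \<in> ?A)}"
    then obtain t ts where s: "s = t \<union> \<Union>(set ts)" "t \<in> ?A" "length ts = p" "sorted_wrt block_less ts"
      "\<forall>t\<in>set ts. t \<in> ?A" "\<forall>t'\<in>set ts. block_less t t'"
      by (auto simp: length_Suc_conv)
    have "\<Union>(set ts) \<in> cnf_family fs (replicate p \<alpha>)" using s unfolding Suc by blast
    with s show "s \<in> cnf_family fs (replicate (Suc p) \<alpha>)"
      using eq[of t ts] joinI[of t ?A "\<Union>(set ts)"] by simp
  qed
qed auto

text \<open>Rule \<open>cnf\<close> lists the highest exponent first, whereas \<open>cnf_val\<close>
  and \<open>cnf_family\<close> start with the lowest; hence the reversal.\<close>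

definition expand_cnf :: "(omega1 \<times> nat) list \<Rightarrow> omega1 list" where
  "expand_cnf cs = concat (map (\<lambda>(\<alpha>, p). replicate p \<alpha>) (rev cs))"

lemma expand_cnf_simps [simp]:
  "expand_cnf [] = []" "expand_cnf (cs @ [(\<alpha>, p)]) = replicate p \<alpha> @ expand_cnf cs"
  by (simp_all add: expand_cnf_def)

lemma cnf_val_expand: "cnf_val (expand_cnf cs) = (\<Sum>(\<alpha>, p)\<leftarrow>cs. omega_mult p \<alpha>)"
  by (induction cs rule: rev_induct) (auto simp: cnf_val_append cnf_val_replicate)

text \<open>The conditions of rule \<open>cnf\<close> on exponents and multiplicities. Exponent 0 is
  excluded, since finite parts of an index are built by rule \<open>plus_one\<close>.\<close>

definition valid_cnf :: "(omega1 \<times> nat) list \<Rightarrow> bool" where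
  "valid_cnf cs \<longleftrightarrow> sorted_wrt (\<lambda>c d. fst c > fst d) cs \<and> (\<forall>(\<alpha>, p)\<in>set cs. \<alpha> > 0 \<and> p \<ge> 1)"

lemma set_expand_cnf: "valid_cnf cs \<Longrightarrow> set (expand_cnf cs) = fst ` set cs"
  by (force simp: expand_cnf_def valid_cnf_def)

lemma valid_cnf_snoc:
  "valid_cnf (cs @ [(\<alpha>, p)]) \<longleftrightarrow> valid_cnf cs \<and> \<alpha> > 0 \<and> p \<ge> 1 \<and> (\<forall>x\<in>fst ` set cs. \<alpha> < x)"
  by (auto simp: valid_cnf_def sorted_wrt_append)

lemma sorted_expand_cnf: "valid_cnf cs \<Longrightarrow> sorted (expand_cnf cs)"
proof (induction cs rule: rev_induct)
  case (snoc c cs)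
  obtain \<alpha> p where c: "c = (\<alpha>, p)" by force
  with snoc show ?case
    by (auto simp: valid_cnf_snoc sorted_append set_expand_cnf order_less_imp_le)
qed simp

text \<open>A new lowest exponent either equals the last exponent of the list, whose multiplicity
  then grows by one, or is smaller and opens a new pair at the end.\<close>

lemma ex_expand_cnf:
  "sorted l \<Longrightarrow> (\<And>x. x \<in> set l \<Longrightarrow> x > 0) \<Longrightarrow> \<exists>cs. valid_cnf cs \<and> expand_cnf cs = l"
proof (induction l)
  case Nil
  then show ?case by (intro exI[of _ "[]"]) (simp add: valid_cnf_def)
next
  case (Cons a l)
  then obtain cs where cs: "valid_cnf cs" "expand_cnf cs = l" by auto
  have le: "a \<le> x" if "x \<in> fst ` set cs" for x
    using Cons.prems(1) that set_expand_cnf[OF cs(1)] cs(2) by auto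
  show ?case
  proof (cases "a \<in> fst ` set cs")
    case False
    then have "valid_cnf (cs @ [(a, 1)])"
      using cs le Cons.prems by (auto simp: valid_cnf_snoc order_less_le)
    then show ?thesis using cs by (intro exI[of _ "cs @ [(a, 1)]"]) simp
  next
    case True
    then obtain cs' b p where cs': "cs = cs' @ [(b, p)]" by (cases cs rule: rev_cases) auto
    with cs(1) le True have "b = a"
      by (force simp: valid_cnf_snoc)
    then have "valid_cnf (cs' @ [(a, Suc p)])" using cs(1) cs' by (simp add: valid_cnf_snoc)
    moreover have "expand_cnf (cs' @ [(a, Suc p)]) = a # l" using cs(2) cs' \<open>b = a\<close> by simp
    ultimately show ?thesis by blast
  qed
qed

text \<open>These are the last three premises of rule \<open>cnf\<close>.\<close>

definition cnf_blocks :: "(omega1 \<Rightarrow> nat \<Rightarrow> omega1) \<Rightarrow> (omega1 \<times> nat) list \<Rightarrow> nat set list list \<Rightarrow> bool" where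
  "cnf_blocks fs cs tss \<longleftrightarrow> length tss = length cs \<and>
    (\<forall>i<length cs. length (tss ! i) = snd (cs ! i) \<and> sorted_wrt block_less (tss ! i) \<and>
         (\<forall>t\<in>set (tss ! i). in_schreier fs (omega_pow (fst (cs ! i))) t)) \<and>
    sorted_wrt (\<lambda>s s'. block_less s' s) (map (\<lambda>ts. \<Union>(set ts)) tss)"

text \<open>The induction adds pairs at the end of \<open>cs\<close>, because the last pair has the
  lowest exponent and its blocks come first in the set.\<close>

lemma cnf_family_expand:
  "cnf_family fs (expand_cnf cs) = {\<Union>ts\<in>set tss. \<Union>(set ts) | tss. cnf_blocks fs cs tss}"
proof (induction cs rule: rev_induct)
  case Nil
  then show ?case by (auto simp: cnf_blocks_def)
next
  case (snoc c cs)
  obtain \<alpha> p where c: "c = (\<alpha>, p)" by force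
  let ?A = "schreier fs (omega_pow \<alpha>)"
  let ?U = "\<lambda>tss. \<Union>ts\<in>set tss. \<Union>(set ts) :: nat set"
  let ?R = "\<lambda>ts. length ts = p \<and> sorted_wrt block_less ts \<and> (\<forall>t\<in>set ts. t \<in> ?A)"
  \<comment> \<open>The new blocks \<open>ts\<close> precede all others, so the order condition of
    rule \<open>cnf\<close> adds one comparison of their union with the union of the rest.\<close>
  have blocks: "cnf_blocks fs (cs @ [c]) (tss @ [ts]) \<longleftrightarrow>
      cnf_blocks fs cs tss \<and> ?R ts \<and> (\<forall>x\<in>\<Union>(set ts). \<forall>y\<in>?U tss. x < y)" for tss ts
  \<comment> \<open>The first case provides the finiteness that turns \<open>block_less\<close> into
    an elementwise comparison; in the second case both sides fail.\<close>
  proof (cases "cnf_blocks fs cs tss \<and> ?R ts")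
    case True
    then have len: "length tss = length cs" by (simp add: cnf_blocks_def)
    have "finite t" if ts': "ts' \<in> set tss" and "t \<in> set ts'" for ts' t
    proof -
      obtain i where "i < length cs" "ts' = tss ! i" using ts' len by (metis in_set_conv_nth)
      moreover have "in_schreier fs (omega_pow (fst (cs ! i))) t"
        using True that(2) calculation unfolding cnf_blocks_def by blast
      ultimately show ?thesis using in_schreier_finite by blast
    qed
    then have "finite (\<Union>(set ts'))" if "ts' \<in> set tss" for ts' using that by blast
    moreover have "finite (\<Union>(set ts))" using True schreier_finite by blast
    ultimately have "(\<forall>ts'\<in>set tss. block_less (\<Union>(set ts)) (\<Union>(set ts'))) \<longleftrightarrow>
        (\<forall>x\<in>\<Union>(set ts). \<forall>y\<in>?U tss. x < y)"
      by (auto simp: block_less_iff)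
    with True c len show ?thesis
      by (auto simp: cnf_blocks_def sorted_wrt_append nth_append less_Suc_eq schreier_def)
  next
    case False
    have "cnf_blocks fs cs tss \<and> ?R ts" if *: "cnf_blocks fs (cs @ [c]) (tss @ [ts])"
    proof -
      have len: "length tss = length cs" using * by (simp add: cnf_blocks_def)
      have i: "length ((tss @ [ts]) ! i) = snd ((cs @ [c]) ! i) \<and> sorted_wrt block_less ((tss @ [ts]) ! i) \<and>
         (\<forall>t\<in>set ((tss @ [ts]) ! i). in_schreier fs (omega_pow (fst ((cs @ [c]) ! i))) t)"
        if "i < Suc (length cs)" for i
        using * that unfolding cnf_blocks_def by simp
      have "?R ts" using i[of "length cs"] c nth_append_length[of tss ts "[]", unfolded len] by (simp add: schreier_def)
      moreover have "length (tss ! i) = snd (cs ! i) \<and> sorted_wrt block_less (tss ! i) \<and>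
         (\<forall>t\<in>set (tss ! i). in_schreier fs (omega_pow (fst (cs ! i))) t)"
        if "i < length cs" for i
        using i[of i] that len by (simp add: nth_append)
      ultimately show ?thesis using * len by (simp add: cnf_blocks_def sorted_wrt_append)
    qed
    with False show ?thesis by blast
  qed
  have "s \<in> cnf_family fs (expand_cnf (cs @ [c])) \<longleftrightarrow> (\<exists>tss. s = ?U tss \<and> cnf_blocks fs (cs @ [c]) tss)" for s
  proof
    assume "s \<in> cnf_family fs (expand_cnf (cs @ [c]))"
    then obtain u v where uv: "s = u \<union> v" "u \<in> cnf_family fs (replicate p \<alpha>)"
      "v \<in> cnf_family fs (expand_cnf cs)" "\<forall>x\<in>u. \<forall>y\<in>v. x < y"
      by (auto simp: c cnf_family_append join_def)
    from uv(2) obtain ts where "u = \<Union>(set ts)" "?R ts"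
      unfolding cnf_family_replicate by blast
    moreover from uv(3) obtain tss where "v = ?U tss" "cnf_blocks fs cs tss"
      unfolding snoc by blast
    ultimately have "s = \<Union>(set ts) \<union> ?U tss" "?R ts" "cnf_blocks fs cs tss"
      "\<forall>x\<in>\<Union>(set ts). \<forall>y\<in>?U tss. x < y"
      using uv by simp_all
    then show "\<exists>tss. s = ?U tss \<and> cnf_blocks fs (cs @ [c]) tss"
      using blocks[of tss ts] by (intro exI[of _ "tss @ [ts]"]) auto
  next
    assume "\<exists>tss. s = ?U tss \<and> cnf_blocks fs (cs @ [c]) tss"
    then obtain tss' where tss': "s = ?U tss'" "cnf_blocks fs (cs @ [c]) tss'" by blast
    then have "tss' \<noteq> []" by (auto simp: cnf_blocks_def)
    then obtain tss ts where "tss' = tss @ [ts]" by (cases tss' rule: rev_cases) auto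
    with tss' blocks[of tss ts] have s: "s = \<Union>(set ts) \<union> ?U tss" and "?R ts" "cnf_blocks fs cs tss"
      and less: "\<forall>x\<in>\<Union>(set ts). \<forall>y\<in>?U tss. x < y"
      by (simp_all add: Un_commute)
    have "\<Union>(set ts) \<in> cnf_family fs (replicate p \<alpha>)"
      unfolding cnf_family_replicate using \<open>?R ts\<close> by blast
    moreover have "?U tss \<in> cnf_family fs (expand_cnf cs)"
      unfolding snoc using \<open>cnf_blocks fs cs tss\<close> by blast
    ultimately show "s \<in> cnf_family fs (expand_cnf (cs @ [c]))"
      unfolding c expand_cnf_simps cnf_family_append join_def using s less by blast
  qed
  then show ?case by blast
qed

text \<open>Inversion of the rules with rule \<open>cnf\<close> restated by expanded lists. At least
  two entries is what separates that case from a single power of \<omega>.\<close>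

lemma in_schreier_cases:
  assumes "in_schreier fs \<xi> s"
  obtains (zero) "\<xi> = 0" "s = {}"
  | (osuc) \<zeta> n t where "\<xi> = osuc \<zeta>" "s = insert n t" "n \<ge> 1" "\<forall>x\<in>t. n < x" "in_schreier fs \<zeta> t"
  | (pow_osuc) \<beta> ss where "\<xi> = omega_pow (osuc \<beta>)" "s = \<Union>(set ss)" "ss \<noteq> []" "length ss = Min (hd ss)"
      "sorted_wrt block_less ss" "\<forall>s\<in>set ss. s \<in> schreier fs (omega_pow \<beta>)"
  | (pow_lim) \<mu> where "\<xi> = omega_pow \<mu>" "is_olim \<mu>" "in_schreier fs (omega_pow (fs \<mu> (Min s))) s"
  | (cnf) cs where "\<xi> = cnf_val (expand_cnf cs)" "valid_cnf cs" "length (expand_cnf cs) \<ge> 2"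
      "s \<in> cnf_family fs (expand_cnf cs)"
  using assms
proof (cases rule: in_schreier.cases)
  case (plus_one n t \<zeta>)
  have "finite t" using in_schreier_finite plus_one by blast
  with plus_one show ?thesis
    using that(2)[of \<zeta> n t] by (simp add: block_less_iff plus_omega1_one)
next
  case (pow_plus_one ss \<beta>)
  then show ?thesis using that(3)[of \<beta> ss] by (simp add: plus_omega1_one schreier_def)
next
  case (cnf cs tss)
  have valid: "valid_cnf cs" using cnf by (simp add: valid_cnf_def)
  obtain c cs' where cs: "cs = c # cs'" using cnf by (cases cs) auto
  have "length (expand_cnf cs) = sum_list (map snd cs)"
    by (simp add: expand_cnf_def length_concat comp_def case_prod_beta rev_map[symmetric])
  also have "\<dots> \<ge> 2"
  proof (cases cs')
    case (Cons d cs'')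
    then show ?thesis using cnf cs by auto
  qed (use cnf cs in auto)
  finally have "length (expand_cnf cs) \<ge> 2" .
  moreover have "s \<in> cnf_family fs (expand_cnf cs)"
    unfolding cnf_family_expand using cnf by (auto simp: cnf_blocks_def)
  ultimately show ?thesis using valid cnf(1) that(5)[of cs] by (simp add: cnf_val_expand)
next
  case zero
  then show ?thesis using that(1) by simp
next
  case (pow_lim \<mu>)
  then show ?thesis using that(4)[of \<mu>] by simp
qed

lemma is_olim_cnf_val: "l \<noteq> [] \<Longrightarrow> 0 < hd l \<Longrightarrow> is_olim (cnf_val l)"
  by (cases l) (simp_all add: is_olim_plus is_olim_omega_pow)

lemma is_olim_pos: "is_olim \<mu> \<Longrightarrow> 0 < \<mu>"
  by (simp add: is_olim_def order_less_le)

lemma osuc_pos [simp]: "0 < osuc x"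
  by (simp add: order_less_le)

lemma omega_pow_inject: "omega_pow \<alpha> = omega_pow \<beta> \<longleftrightarrow> \<alpha> = \<beta>"
  by (metis linorder_neqE omega_pow_strict_mono order_less_irrefl)

lemma is_olim_cnf_val_expand:
  assumes "valid_cnf cs" "length (expand_cnf cs) \<ge> 2"
  shows "is_olim (cnf_val (expand_cnf cs))"
proof -
  have ne: "expand_cnf cs \<noteq> []" using assms(2) by auto
  then have "hd (expand_cnf cs) \<in> fst ` set cs" using set_expand_cnf[OF assms(1)] by auto
  then have "0 < hd (expand_cnf cs)" using assms(1) by (auto simp: valid_cnf_def)
  with ne show ?thesis by (rule is_olim_cnf_val)
qed

lemma cnf_val_expand_neq_omega_pow:
  assumes "valid_cnf cs" "length (expand_cnf cs) \<ge> 2"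
  shows "cnf_val (expand_cnf cs) \<noteq> omega_pow \<alpha>"
proof
  assume "cnf_val (expand_cnf cs) = omega_pow \<alpha>"
  then have "expand_cnf cs = [\<alpha>]"
    by (intro cnf_val_inject) (simp_all add: sorted_expand_cnf assms(1))
  with assms(2) show False by simp
qed

lemma schreier_zero: "schreier fs 0 = {{}}"
proof -
  have "s = {}" if "in_schreier fs 0 s" for s
    using that by (cases rule: in_schreier_cases) auto
  then show ?thesis by (auto simp: schreier_def intro: in_schreier.zero)
qed

text \<open>Only rule \<open>plus_one\<close> can derive a successor index: the remaining rules
  yield 0, a power of \<omega> with positive exponent, or a longer normal form with positive
  exponents, and the last two are limits.\<close>

lemma schreier_osuc:
  "schreier fs (osuc \<zeta>) = {insert n t | n t. n \<ge> 1 \<and> (\<forall>x\<in>t. n < x) \<and> t \<in> schreier fs \<zeta>}"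
proof (intro equalityI subsetI)
  fix s assume "s \<in> schreier fs (osuc \<zeta>)"
  then have "in_schreier fs (osuc \<zeta>) s" by (simp add: schreier_def)
  then show "s \<in> {insert n t | n t. n \<ge> 1 \<and> (\<forall>x\<in>t. n < x) \<and> t \<in> schreier fs \<zeta>}"
  proof (cases rule: in_schreier_cases)
    case (osuc \<zeta>' n t)
    then show ?thesis by (auto simp: schreier_def)
  next
    case (pow_osuc \<beta> ss)
    then show ?thesis using is_olim_omega_pow[of "osuc \<beta>"] by (metis not_is_olim(2) osuc_pos)
  next
    case (pow_lim \<mu>)
    then show ?thesis using is_olim_omega_pow[of \<mu>] by (metis not_is_olim(2) is_olim_pos)
  next
    case (cnf cs)
    then show ?thesis using is_olim_cnf_val_expand[of cs] by (metis not_is_olim(2))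
  qed auto
next
  fix s assume "s \<in> {insert n t | n t. n \<ge> 1 \<and> (\<forall>x\<in>t. n < x) \<and> t \<in> schreier fs \<zeta>}"
  then obtain n t where nt: "s = insert n t" "n \<ge> 1" "\<forall>x\<in>t. n < x" "in_schreier fs \<zeta> t"
    by (auto simp: schreier_def)
  then have "block_less {n} t" using in_schreier_finite[OF nt(4)] by (simp add: block_less_iff)
  then show "s \<in> schreier fs (osuc \<zeta>)"
    using in_schreier.plus_one[OF nt(2) _ nt(4)] nt(1) by (simp add: schreier_def plus_omega1_one)
qed

lemma schreier_one: "schreier fs (omega_pow 0) = {{n} | n. n \<ge> 1}"
  by (auto simp: omega_pow_zero one_omega1_def schreier_osuc schreier_zero)

text \<open>A lowest exponent 0 is split off by rule \<open>plus_one\<close>, and a single exponent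
  is immediate. Otherwise the index is a limit but no power of \<omega>, so only rule
  \<open>cnf\<close> applies, and uniqueness of normal forms determines its parameters.\<close>

lemma schreier_cnf_val:
  "sorted l \<Longrightarrow> schreier fs (cnf_val l) = cnf_family fs l"
proof (induction l)
  case Nil
  then show ?case by (simp add: schreier_zero)
next
  case (Cons a r)
  then have IH: "schreier fs (cnf_val r) = cnf_family fs r" by simp
  consider "a = 0" | "r = []" | "a \<noteq> 0" "r \<noteq> []" by blast
  then show ?case
  proof cases
    case 1
    then have "cnf_val (a # r) = osuc (cnf_val r)"
      by (simp add: omega_pow_zero plus_omega1_one)
    then show ?thesis
      using 1 by (auto simp: schreier_osuc schreier_one IH join_def)
  next
    case 2
    then show ?thesis by simp
  next
    case 3
    have pos: "x > 0" if "x \<in> set (a # r)" for x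
    proof -
      have "0 < a" using 3(1) by (simp add: order_less_le)
      moreover have "a \<le> x" using that Cons.prems by auto
      ultimately show ?thesis by (rule order_less_le_trans)
    qed
    have lim: "is_olim (cnf_val (a # r))" using pos by (intro is_olim_cnf_val) simp_all
    have npow: "cnf_val (a # r) \<noteq> omega_pow \<alpha>" for \<alpha>
      using cnf_val_inject[OF Cons.prems, of "[\<alpha>]"] 3(2) by auto
    have "s \<in> cnf_family fs (a # r)" if "in_schreier fs (cnf_val (a # r)) s" for s
      using that
    proof (cases rule: in_schreier_cases)
      case (osuc \<zeta> n t)
      then show ?thesis using lim by (metis not_is_olim(2))
    next
      case (cnf cs)
      then show ?thesis using cnf_val_inject[OF Cons.prems sorted_expand_cnf[of cs]] by metis
    next
      case zero
      then show ?thesis using lim by simp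
    qed (use npow in blast)+
    moreover have "in_schreier fs (cnf_val (a # r)) s" if "s \<in> cnf_family fs (a # r)" for s
    proof -
      obtain cs where cs: "valid_cnf cs" "expand_cnf cs = a # r"
        using ex_expand_cnf[OF Cons.prems pos] by blast
      have "s \<in> cnf_family fs (expand_cnf cs)" using that cs(2) by simp
      then obtain tss where tss: "s = (\<Union>ts\<in>set tss. \<Union>(set ts))" "cnf_blocks fs cs tss"
        unfolding cnf_family_expand by blast
      have "cs \<noteq> []" using cs(2) by auto
      moreover have "length cs \<ge> 2 \<or> snd (hd cs) \<ge> 2"
      proof (rule ccontr)
        assume neg: "\<not> (length cs \<ge> 2 \<or> snd (hd cs) \<ge> 2)"
        then obtain c where "cs = [c]" using \<open>cs \<noteq> []\<close> by (cases cs; cases "tl cs") auto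
        then have "length (expand_cnf cs) < 2" using neg by (auto simp: expand_cnf_def case_prod_beta)
        then show False using cs(2) 3(2) by (cases r) auto
      qed
      ultimately have "in_schreier fs (\<Sum>(\<alpha>, p)\<leftarrow>cs. omega_mult p \<alpha>) (\<Union>ts\<in>set tss. \<Union>(set ts))"
        using cs(1) tss(2) unfolding valid_cnf_def cnf_blocks_def by (intro in_schreier.cnf) blast+
      then show ?thesis by (simp only: tss(1) cs(2)[symmetric] cnf_val_expand)
    qed
    ultimately show ?thesis by (auto simp: schreier_def)
  qed
qed

lemma schreier_pow_lim:
  assumes "is_olim \<mu>"
  shows "s \<in> schreier fs (omega_pow \<mu>) \<longleftrightarrow> s \<in> schreier fs (omega_pow (fs \<mu> (Min s)))"
proof -
  have "in_schreier fs (omega_pow (fs \<mu> (Min s))) s" if "in_schreier fs (omega_pow \<mu>) s"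
    using that
  proof (cases rule: in_schreier_cases)
    case (osuc \<zeta> n t)
    then show ?thesis using is_olim_omega_pow[of \<mu>] assms by (metis not_is_olim(2) is_olim_pos)
  next
    case (pow_osuc \<beta> ss)
    then show ?thesis using assms by (auto simp: omega_pow_inject)
  next
    case (pow_lim \<mu>')
    then show ?thesis by (simp add: omega_pow_inject)
  next
    case (cnf cs)
    then show ?thesis using cnf_val_expand_neq_omega_pow by metis
  qed simp
  then show ?thesis using in_schreier.pow_lim[OF assms] by (auto simp: schreier_def)
qed

text \<open>Rule \<open>pow_plus_one\<close> takes the number of blocks from the first block. This
  recovers that number from the union alone.\<close>

lemma Min_Union_block_less:
  assumes "sorted_wrt block_less ss" "ss \<noteq> []" "\<forall>t\<in>set ss. t \<in> schreier fs (omega_pow \<beta>)"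
  shows "Min (\<Union>(set ss)) = Min (hd ss)"
proof -
  obtain t ts where ss: "ss = t # ts" using assms(2) by (cases ss) auto
  have fin: "finite u" if "u \<in> set ss" for u using that assms(3) schreier_finite by blast
  have t: "finite t" "t \<noteq> {}" using fin assms(3) schreier_nonempty[of t fs "omega_pow \<beta>"] ss by auto
  have "Min t \<le> y" if "y \<in> \<Union>(set ss)" for y
  proof -
    consider "y \<in> t" | u where "u \<in> set ts" "y \<in> u" using \<open>y \<in> \<Union>(set ss)\<close> ss by auto
    then show ?thesis
    proof cases
      case 1
      then show ?thesis using t by simp
    next
      case 2
      then have "block_less t u" using assms(1) ss by simp
      moreover have "Min t \<in> t" using t by simp
      moreover have "finite u" using fin 2 ss by simp
      ultimately show ?thesis
        using 2(2) t(1) by (auto simp: block_less_iff intro: order_less_imp_le)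
    qed
  qed
  moreover have "finite (\<Union>(set ss))" using fin by auto
  moreover have "Min t \<in> \<Union>(set ss)" using t ss by simp
  ultimately have "Min (\<Union>(set ss)) = Min t" by (intro Min_eqI) auto
  then show ?thesis by (simp add: ss)
qed

lemma schreier_pow_osuc:
  "s \<in> schreier fs (omega_pow (osuc \<beta>)) \<longleftrightarrow>
     s \<noteq> {} \<and> s \<in> cnf_family fs (replicate (Min s) \<beta>)"
proof
  assume s: "s \<in> schreier fs (omega_pow (osuc \<beta>))"
  then have "in_schreier fs (omega_pow (osuc \<beta>)) s" by (simp add: schreier_def)
  then show "s \<noteq> {} \<and> s \<in> cnf_family fs (replicate (Min s) \<beta>)"
  proof (cases rule: in_schreier_cases)
    case (osuc \<zeta> n t)
    then show ?thesis using is_olim_omega_pow[of "osuc \<beta>"] by (metis not_is_olim(2) osuc_pos)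
  next
    case (pow_osuc \<beta>' ss)
    have [simp]: "\<beta>' = \<beta>" using pow_osuc(1) by (simp add: omega_pow_inject)
    have "length ss = Min s"
      unfolding pow_osuc(2,4) by (rule Min_Union_block_less[symmetric, OF pow_osuc(5,3,6)])
    then show ?thesis
      using pow_osuc(2,5,6) schreier_nonempty[OF s] unfolding cnf_family_replicate by auto
  next
    case (pow_lim \<mu>)
    then show ?thesis by (auto simp: omega_pow_inject)
  next
    case (cnf cs)
    then show ?thesis using cnf_val_expand_neq_omega_pow by metis
  qed simp
next
  assume s: "s \<noteq> {} \<and> s \<in> cnf_family fs (replicate (Min s) \<beta>)"
  then obtain ss where ss: "s = \<Union>(set ss)" "length ss = Min s" "sorted_wrt block_less ss"
    "\<forall>t\<in>set ss. t \<in> schreier fs (omega_pow \<beta>)"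
    unfolding cnf_family_replicate by blast
  then have "ss \<noteq> []" using s by auto
  then have "Min s = Min (hd ss)" unfolding ss(1) using ss(3,4) by (intro Min_Union_block_less)
  with ss \<open>ss \<noteq> []\<close> have "in_schreier fs (omega_pow (\<beta> + 1)) (\<Union>(set ss))"
    by (intro in_schreier.pow_plus_one) (auto simp: schreier_def)
  then show "s \<in> schreier fs (omega_pow (osuc \<beta>))"
    by (simp add: schreier_def ss(1) plus_omega1_one)
qed

lemma cnf_family_finite: "s \<in> cnf_family fs l \<Longrightarrow> finite s"
  by (induction l arbitrary: s) (auto simp: join_def schreier_finite)

section \<open>Sections of the families at the minimum of their members\<close>

text \<open>
  The members of the family with index \<open>\<omega>\<^sup>\<alpha>\<close> that have minimum \<open>n\<close> are the sets
  \<open>{n} \<union> s\<close> with \<open>s\<close> in the family of this normal form.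
\<close>

definition section_cnf :: "(omega1 \<Rightarrow> nat \<Rightarrow> omega1) \<Rightarrow> omega1 \<Rightarrow> nat \<Rightarrow> omega1 list" where
  "section_cnf fs = omega1_rec (\<lambda>n. []) (\<lambda>\<beta> v n. v n @ replicate (n - 1) \<beta>)
     (\<lambda>\<mu> f n. if n = 0 then [] else f (fs \<mu> n) n)"

context
  fixes fs :: "omega1 \<Rightarrow> nat \<Rightarrow> omega1"
  assumes fs: "fundamental_sequences fs"
begin

lemma fs_less: "is_olim \<mu> \<Longrightarrow> n \<ge> 1 \<Longrightarrow> fs \<mu> n < \<mu>"
  and fs_is_osuc: "is_olim \<mu> \<Longrightarrow> n \<ge> 1 \<Longrightarrow> is_osuc (fs \<mu> n)"
  and fs_strict_mono: "is_olim \<mu> \<Longrightarrow> strict_mono_on {1..} (fs \<mu>)"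
  and fs_Sup: "is_olim \<mu> \<Longrightarrow> (SUP n\<in>{1..}. fs \<mu> n) = \<mu>"
  using fs unfolding fundamental_sequences_def by auto

lemma section_cnf_zero: "section_cnf fs 0 n = []"
  by (simp add: section_cnf_def omega1_rec_zero)

lemma section_cnf_osuc: "section_cnf fs (osuc \<beta>) n = section_cnf fs \<beta> n @ replicate (n - 1) \<beta>"
  by (simp add: section_cnf_def omega1_rec_osuc)

lemma section_cnf_lim:
  assumes "is_olim \<mu>" "n \<ge> 1"
  shows "section_cnf fs \<mu> n = section_cnf fs (fs \<mu> n) n"
proof -
  have "section_cnf fs \<mu> = (\<lambda>n. if n = 0 then [] else section_cnf fs (fs \<mu> n) n)"
    unfolding section_cnf_def
    \<comment> \<open>Nothing bounds \<open>fs \<mu> 0\<close>. The default value at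
      \<open>n = 0\<close> ensures that the limit clause depends only on values below \<mu>.\<close>
    by (rule omega1_rec_lim[OF assms(1)]) (use fs_less[OF assms(1)] in \<open>auto simp: fun_eq_iff\<close>)
  with assms(2) show ?thesis by (metis not_one_le_zero)
qed

lemma section_cnf_sorted_less:
  "n \<ge> 1 \<Longrightarrow> sorted (section_cnf fs \<alpha> n) \<and> (\<forall>x\<in>set (section_cnf fs \<alpha> n). x < \<alpha>)"
proof (induction \<alpha> rule: omega1_induct)
  case (osuc \<alpha>)
  have "x < osuc \<alpha>" if "x < \<alpha>" for x using that less_osuc order_less_trans by blast
  with osuc show ?case
    by (auto simp: section_cnf_osuc sorted_append order_less_imp_le)
next
  case (lim \<mu>)
  then show ?case using fs_less[OF lim(1) lim(3)] section_cnf_lim[OF lim(1) lim(3)]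
    by (metis order_less_trans)
qed (simp add: section_cnf_zero)

lemma Min_insert_greater: "finite s \<Longrightarrow> s \<subseteq> {n<..} \<Longrightarrow> Min (insert n s) = (n :: nat)"
  by (rule Min_eqI) (auto intro: order_less_imp_le)

text \<open>At a successor exponent the minimum \<open>n\<close> prescribes \<open>n\<close> blocks:
  the first loses \<open>n\<close> and becomes a section, the other \<open>n - 1\<close> stay whole.
  At a limit exponent \<open>n\<close> selects the exponent \<open>fs \<mu> n\<close>.\<close>

lemma insert_in_schreier_omega_pow_iff:
  "n \<ge> 1 \<Longrightarrow> s \<subseteq> {n<..} \<Longrightarrow>
    insert n s \<in> schreier fs (omega_pow \<alpha>) \<longleftrightarrow> s \<in> cnf_family fs (section_cnf fs \<alpha> n)"
proof (induction \<alpha> arbitrary: s rule: omega1_induct)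
  case zero
  then have "n \<notin> s" by auto
  with zero show ?case by (auto simp: schreier_one section_cnf_zero)
next
  case (osuc \<beta>)
  show ?case
  proof (cases "finite s")
    case True
    have "insert n s \<in> schreier fs (omega_pow (osuc \<beta>)) \<longleftrightarrow>
        insert n s \<in> cnf_family fs (\<beta> # replicate (n - 1) \<beta>)"
      using osuc.prems Min_insert_greater[OF True] by (cases n) (simp_all add: schreier_pow_osuc)
    also have "\<dots> \<longleftrightarrow> s \<in> join (cnf_family fs (section_cnf fs \<beta> n)) (cnf_family fs (replicate (n - 1) \<beta>))"
      unfolding cnf_family.simps
      by (rule join_insert_iff) (use osuc schreier_nonempty in auto)
    finally show ?thesis by (simp add: section_cnf_osuc cnf_family_append)
  next
    case False
    then show ?thesis by (auto dest: schreier_finite cnf_family_finite)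
  qed
next
  case (lim \<mu>)
  show ?case
  proof (cases "finite s")
    case True
    have "insert n s \<in> schreier fs (omega_pow \<mu>) \<longleftrightarrow> insert n s \<in> schreier fs (omega_pow (fs \<mu> n))"
      using schreier_pow_lim[OF lim(1), of "insert n s"] Min_insert_greater[OF True lim.prems(2)] by simp
    then show ?thesis
      using lim fs_less section_cnf_lim by simp
  next
    case False
    then show ?thesis by (auto dest: schreier_finite cnf_family_finite)
  qed
qed

text \<open>At a successor exponent the section contains \<open>n - 1\<close> copies of the previous
  power, and these multiples are cofinal. At a limit, \<open>fs \<alpha> n\<close> is a successor
  \<open>osuc \<delta>\<close> with \<delta> eventually at least any given \<gamma> below \<alpha>,
  so one copy of \<open>omega_pow \<delta>\<close> suffices.\<close>

lemma eventually_le_section_cnf: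
  assumes "\<eta> < omega_pow \<alpha>"
  shows "\<forall>\<^sub>F n in sequentially. \<eta> \<le> cnf_val (section_cnf fs \<alpha> n)"
proof -
  have le: "omega_mult (n - 1) \<beta> \<le> cnf_val (section_cnf fs (osuc \<beta>) n)" for n \<beta>
    by (simp add: section_cnf_osuc cnf_val_append cnf_val_replicate le_plus_omega1_left)
  consider "\<alpha> = 0" | \<beta> where "\<alpha> = osuc \<beta>" | "is_olim \<alpha>"
    by (auto simp: is_olim_def is_osuc_def)
  then show ?thesis
  proof cases
    case 1
    then have "\<eta> \<le> 0" using assms by (simp add: omega_pow_zero one_omega1_def less_osuc_iff)
    then show ?thesis by (simp add: always_eventually order_trans[OF _ zero_le_omega1])
  next
    case 2
    with assms obtain p where p: "\<eta> < omega_mult p \<beta>" by (auto simp: less_omega_pow_osuc_iff)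
    have "\<eta> \<le> cnf_val (section_cnf fs \<alpha> n)" if "n \<ge> Suc p" for n
    proof -
      have "\<eta> \<le> omega_mult p \<beta>" using p by simp
      also have "\<dots> \<le> omega_mult (n - 1) \<beta>" using that by (intro omega_mult_mono) simp
      also note le
      finally show ?thesis by (simp add: 2)
    qed
    then show ?thesis by (auto simp: eventually_sequentially)
  next
    case 3
    with assms obtain \<gamma> where \<gamma>: "\<gamma> < \<alpha>" "\<eta> < omega_pow \<gamma>" by (auto simp: less_omega_pow_olim_iff)
    have "\<gamma> < (SUP n\<in>{1..}. fs \<alpha> n)" using \<gamma> fs_Sup[OF 3] by simp
    then obtain N where N: "N \<ge> 1" "\<gamma> < fs \<alpha> N"
      by (subst (asm) less_cSUP_iff) (auto intro: bdd_above_countable_omega1)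
    \<comment> \<open>As \<open>N \<ge> 1\<close>, this bound gives \<open>n - 1 \<ge> 1\<close>,
      hence at least one copy of \<open>omega_pow \<delta>\<close>.\<close>
    have "\<eta> \<le> cnf_val (section_cnf fs \<alpha> n)" if n: "n \<ge> Suc N" for n
    proof -
      have "fs \<alpha> N < fs \<alpha> n" using strict_mono_onD[OF fs_strict_mono[OF 3], of N n] N n by auto
      then have "\<gamma> < fs \<alpha> n" using N by simp
      moreover obtain \<delta> where \<delta>: "fs \<alpha> n = osuc \<delta>" using fs_is_osuc[OF 3, of n] n by (auto simp: is_osuc_def)
      ultimately have "\<gamma> \<le> \<delta>" by (simp add: less_osuc_iff)
      have "\<eta> \<le> omega_pow \<delta>" using \<gamma>(2) omega_pow_mono[OF \<open>\<gamma> \<le> \<delta>\<close>] by simp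
      also have "\<dots> = omega_mult 1 \<delta>" by simp
      also have "\<dots> \<le> omega_mult (n - 1) \<delta>" using n N by (intro omega_mult_mono) simp
      also note le
      also have "section_cnf fs (osuc \<delta>) n = section_cnf fs \<alpha> n" using section_cnf_lim[OF 3, of n] n \<delta> by simp
      finally show ?thesis .
    qed
    then show ?thesis by (auto simp: eventually_sequentially)
  qed
qed

text \<open>The minimum lies in the block of the lowest exponent \<open>a\<close>. Removing it
  replaces this block by its section and keeps the remaining exponents \<open>r\<close>, which gives
  the index \<open>f n\<close>.\<close>

lemma ex_schreier_section:
  assumes "\<xi> \<noteq> 0"
  shows "\<exists>f. (\<forall>n\<ge>1. f n < \<xi> \<and> (\<forall>s\<subseteq>{n<..}. insert n s \<in> schreier fs \<xi> \<longleftrightarrow> s \<in> schreier fs (f n))) \<and>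
    (\<forall>\<eta><\<xi>. \<forall>\<^sub>F n in sequentially. \<eta> \<le> f n)"
proof -
  obtain l where l: "sorted l" "cnf_val l = \<xi>" using cnf_exists by blast
  with assms obtain a r where ar: "l = a # r" by (cases l) auto
  define f where "f n = cnf_val (section_cnf fs a n @ r)" for n
  have "f n < \<xi>" if "n \<ge> 1" for n
    using cnf_val_less[of "section_cnf fs a n" a] section_cnf_sorted_less[OF that, of a] l(2) ar
    by (auto simp: f_def cnf_val_append)
  moreover have "insert n s \<in> schreier fs \<xi> \<longleftrightarrow> s \<in> schreier fs (f n)" if n: "n \<ge> 1" "s \<subseteq> {n<..}" for n s
  proof -
    have "sorted (section_cnf fs a n @ r)"
      using section_cnf_sorted_less[OF n(1), of a] l(1) ar
      by (auto simp: sorted_append intro: order_less_imp_le order_less_le_trans)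
    then have "s \<in> schreier fs (f n) \<longleftrightarrow> s \<in> join (cnf_family fs (section_cnf fs a n)) (cnf_family fs r)"
      by (simp add: f_def schreier_cnf_val cnf_family_append)
    also have "\<dots> \<longleftrightarrow> insert n s \<in> cnf_family fs (a # r)"
      unfolding cnf_family.simps
      by (rule sym, rule join_insert_iff)
        (use n insert_in_schreier_omega_pow_iff[OF n(1)] schreier_nonempty in auto)
    finally show ?thesis using schreier_cnf_val[OF l(1), of fs] l(2) ar by simp
  qed
  moreover have "\<forall>\<^sub>F n in sequentially. \<eta> \<le> f n" if \<eta>: "\<eta> < \<xi>" for \<eta>
  proof -
    \<comment> \<open>Continuity of addition at the limit \<open>omega_pow a\<close>; for
      \<open>a = 0\<close> this power is 1 and \<theta> is 0.\<close>
    have "\<exists>\<theta><omega_pow a. \<eta> \<le> cnf_val r + \<theta>"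
    proof (cases "a = 0")
      case True
      then have "\<eta> \<le> cnf_val r + 0"
        using \<eta> l(2) ar by (auto simp: omega_pow_zero plus_omega1_one simp flip: less_osuc_iff)
      then show ?thesis using omega_pow_pos by blast
    next
      case False
      then have "is_olim (omega_pow a)" by (simp add: is_olim_omega_pow order_less_le)
      then show ?thesis
        using \<eta> l(2) ar less_plus_olim_iff by (metis cnf_val.simps(2) order_less_imp_le)
    qed
    then obtain \<theta> where \<theta>: "\<theta> < omega_pow a" "\<eta> \<le> cnf_val r + \<theta>" by blast
    show ?thesis
      using eventually_le_section_cnf[OF \<theta>(1)]
    proof eventually_elim
      case (elim n)
      then show ?case
        using \<theta>(2) plus_omega1_mono_right[OF elim, of "cnf_val r"] by (simp add: f_def cnf_val_append)
    qed
  qed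
  ultimately show ?thesis by (intro exI[of _ f]) blast
qed

end

section \<open>Ramsey theory of the Schreier families\<close>

text \<open>Build decreasing infinite sets \<open>J k\<close> such that \<open>J (Suc k)\<close>
  lies above the minimum of \<open>J k\<close> and is good for it. In the set of all these minima,
  the part above the \<open>k\<close>-th one is contained in \<open>J (Suc k)\<close>.\<close>

lemma diagonalization:
  assumes I: "infinite (I :: nat set)"
    and ex: "\<And>n J. n \<in> I \<Longrightarrow> J \<subseteq> I \<Longrightarrow> infinite J \<Longrightarrow> \<exists>K\<subseteq>J. infinite K \<and> P n K"
    and mono: "\<And>n J K. P n J \<Longrightarrow> K \<subseteq> J \<Longrightarrow> P n K"
  shows "\<exists>L\<subseteq>I. infinite L \<and> (\<forall>n\<in>L. P n (L \<inter> {n<..}))"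
proof -
  have step: "\<exists>K. (K \<subseteq> I \<and> infinite K) \<and> (K \<subseteq> J \<inter> {Inf J<..} \<and> P (Inf J) K)"
    if J: "J \<subseteq> I \<and> infinite J" for J
  proof -
    have "Inf J \<in> I" using J by (metis Inf_nat_def1 finite.emptyI subsetD)
    moreover have "infinite (J \<inter> {Inf J<..})"
    proof -
      have "J - (J \<inter> {Inf J<..}) \<subseteq> {..Inf J}" by auto
      then have "finite (J - (J \<inter> {Inf J<..}))" by (rule finite_subset) simp
      with J show ?thesis by (metis Diff_infinite_finite Diff_Diff_Int Int_absorb1 Int_lower1)
    qed
    ultimately obtain K where "K \<subseteq> J \<inter> {Inf J<..}" "infinite K" "P (Inf J) K"
      using ex[of "Inf J" "J \<inter> {Inf J<..}"] J by blast
    with J show ?thesis by blast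
  qed
  obtain J where J: "\<And>k :: nat. J k \<subseteq> I \<and> infinite (J k)"
    and JS: "\<And>k. J (Suc k) \<subseteq> J k \<inter> {Inf (J k)<..} \<and> P (Inf (J k)) (J (Suc k))"
    using dependent_nat_choice[of "\<lambda>_ J. J \<subseteq> I \<and> infinite J"
        "\<lambda>_ J K. K \<subseteq> J \<inter> {Inf J<..} \<and> P (Inf J) K"] step I by (metis order_refl)
  define m where "m k = Inf (J k)" for k
  have mJ: "m k \<in> J k" for k
    unfolding m_def using J[of k] by (metis Inf_nat_def1 finite.emptyI)
  have anti: "J l \<subseteq> J k" if "k \<le> l" for k l
    by (rule lift_Suc_antimono_le[OF _ that]) (use JS in blast)
  have less: "m k < m (Suc k)" for k using mJ[of "Suc k"] JS[of k] by (auto simp: m_def)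
  have mono_m: "strict_mono m" by (rule strict_mono_Suc_iff[THEN iffD2]) (use less in blast)
  have "P (m k) (range m \<inter> {m k<..})" for k
  proof (rule mono)
    show "P (m k) (J (Suc k))" using JS[of k] by (simp add: m_def)
    show "range m \<inter> {m k<..} \<subseteq> J (Suc k)"
    proof clarify
      fix j assume "m k < m j"
      then have "Suc k \<le> j" using mono_m by (simp add: strict_mono_less)
      then show "m j \<in> J (Suc k)" using anti mJ by blast
    qed
  qed
  moreover have "infinite (range m)"
    using strict_mono_imp_inj_on[OF mono_m] by (simp add: finite_image_iff)
  moreover have "range m \<subseteq> I" using mJ J by blast
  ultimately show ?thesis by (intro exI[of _ "range m"]) blast
qed

lemma infinite_greater:
  assumes "infinite (L :: nat set)" "finite t"
  shows "infinite {x \<in> L. \<forall>y\<in>t. y < x}"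
proof
  assume "finite {x \<in> L. \<forall>y\<in>t. y < x}"
  moreover have "L \<subseteq> {x \<in> L. \<forall>y\<in>t. y < x} \<union> (\<Union>y\<in>t. {..y})" by (auto simp: not_less)
  ultimately show False using assms by (meson finite_UN finite_Un finite_atMost finite_subset)
qed

lemma infinite_Int_greaterThan: "infinite (L :: nat set) \<Longrightarrow> infinite (L \<inter> {n<..})"
  using infinite_greater[of L "{n}"] by (simp add: Int_def)

section \<open>Derivatives described by finite exceptional sets\<close>

definition hereditary :: "nat set set \<Rightarrow> bool" where
  "hereditary G \<longleftrightarrow> (\<forall>s\<in>G. \<forall>t\<subseteq>s. t \<in> G)"

lemma hereditaryD: "hereditary G \<Longrightarrow> s \<in> G \<Longrightarrow> t \<subseteq> s \<Longrightarrow> t \<in> G"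
  by (auto simp: hereditary_def)

text \<open>
  On hereditary families and for \<open>F \<subseteq> L\<close> this agrees with the strong Cantor--Bendixson
  derivative; not requiring \<open>F \<subseteq> L\<close> makes it monotone under shrinking \<open>L\<close>.
\<close>

function cb_deriv :: "nat set set \<Rightarrow> nat set \<Rightarrow> omega1 \<Rightarrow> nat set set" where
  "cb_deriv G L \<xi> = {F \<in> G. \<forall>\<eta><\<xi>. finite {n \<in> L. insert n F \<notin> cb_deriv G L \<eta>}}"
  by auto
termination
  by (relation "inv_image {(x, y). x < y} (\<lambda>(G, L, \<xi>). \<xi>)") (auto simp: wf)

declare cb_deriv.simps [simp del]

lemma cb_deriv_iff: "F \<in> cb_deriv G L \<xi> \<longleftrightarrow> F \<in> G \<and> (\<forall>\<eta><\<xi>. finite {n \<in> L. insert n F \<notin> cb_deriv G L \<eta>})"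
  by (subst cb_deriv.simps) simp

lemma cb_deriv_zero: "cb_deriv G L 0 = G"
  by (auto simp: cb_deriv_iff[of _ _ _ 0] leD)

lemma cb_deriv_subset: "cb_deriv G L \<xi> \<subseteq> G"
  by (auto simp: cb_deriv_iff[of _ _ _ \<xi>])

lemma cb_deriv_antimono: "\<eta> \<le> \<xi> \<Longrightarrow> cb_deriv G L \<xi> \<subseteq> cb_deriv G L \<eta>"
  by (auto simp: cb_deriv_iff[of _ _ _ \<xi>] cb_deriv_iff[of _ _ _ \<eta>])

lemma cb_deriv_osuc:
  "F \<in> cb_deriv G L (osuc \<xi>) \<longleftrightarrow> F \<in> cb_deriv G L \<xi> \<and> finite {n \<in> L. insert n F \<notin> cb_deriv G L \<xi>}"
  unfolding cb_deriv_iff[of _ _ _ "osuc \<xi>"] cb_deriv_iff[of F _ _ \<xi>] less_osuc_iff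
  by (auto simp: order_le_less)

text \<open>The finiteness condition at \<eta> is part of membership in the derivative of order
  \<open>osuc \<eta>\<close>, which is still below the limit.\<close>

lemma cb_deriv_lim:
  assumes "is_olim \<mu>"
  shows "F \<in> cb_deriv G L \<mu> \<longleftrightarrow> (\<forall>\<beta><\<mu>. F \<in> cb_deriv G L \<beta>)"
proof
  assume *: "\<forall>\<beta><\<mu>. F \<in> cb_deriv G L \<beta>"
  have "finite {n \<in> L. insert n F \<notin> cb_deriv G L \<eta>}" if "\<eta> < \<mu>" for \<eta>
    using * osuc_less_olim[OF assms that] cb_deriv_osuc by blast
  moreover have "F \<in> G" using * is_olim_pos[OF assms] cb_deriv_zero by blast
  ultimately show "F \<in> cb_deriv G L \<mu>" by (simp add: cb_deriv_iff[of F])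
qed (meson cb_deriv_antimono order_less_imp_le subsetD)

text \<open>An exceptional point for \<open>L'\<close> lies in the finite set \<open>L' - L\<close>
  or, by induction, is exceptional for \<open>L\<close>. This permits both shrinking
  \<open>L\<close> and restoring finitely many points.\<close>

lemma cb_deriv_almost_mono: "finite (L' - L) \<Longrightarrow> cb_deriv G L \<xi> \<subseteq> cb_deriv G L' \<xi>"
proof (induction \<xi> rule: less_induct)
  case (less \<xi>)
  show ?case
  proof
    fix F assume F: "F \<in> cb_deriv G L \<xi>"
    have "finite {n \<in> L'. insert n F \<notin> cb_deriv G L' \<eta>}" if "\<eta> < \<xi>" for \<eta>
    proof (rule finite_subset)
      show "{n \<in> L'. insert n F \<notin> cb_deriv G L' \<eta>} \<subseteq> (L' - L) \<union> {n \<in> L. insert n F \<notin> cb_deriv G L \<eta>}"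
        using less that by blast
      show "finite ((L' - L) \<union> {n \<in> L. insert n F \<notin> cb_deriv G L \<eta>})"
        using less.prems F that by (simp add: cb_deriv_iff[of F])
    qed
    then show "F \<in> cb_deriv G L' \<xi>" using F by (simp add: cb_deriv_iff[of F])
  qed
qed

text \<open>By induction, every point exceptional for a subset of \<open>F\<close> is exceptional
  for \<open>F\<close> as well.\<close>

lemma hereditary_cb_deriv: "hereditary G \<Longrightarrow> hereditary (cb_deriv G L \<xi>)"
proof (induction \<xi> rule: less_induct)
  case (less \<xi>)
  have "F' \<in> cb_deriv G L \<xi>" if F: "F \<in> cb_deriv G L \<xi>" "F' \<subseteq> F" for F F'
  proof -
    have "finite {n \<in> L. insert n F' \<notin> cb_deriv G L \<eta>}" if "\<eta> < \<xi>" for \<eta>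
    proof (rule finite_subset)
      show "{n \<in> L. insert n F' \<notin> cb_deriv G L \<eta>} \<subseteq> {n \<in> L. insert n F \<notin> cb_deriv G L \<eta>}"
        using hereditaryD[OF less.IH[OF that less.prems], of "insert n F" "insert n F'" for n] F(2) by blast
      show "finite {n \<in> L. insert n F \<notin> cb_deriv G L \<eta>}" using F(1) that by (simp add: cb_deriv_iff[of F])
    qed
    moreover have "F' \<in> G" using F less.prems cb_deriv_subset hereditaryD by blast
    ultimately show ?thesis by (simp add: cb_deriv_iff[of F'])
  qed
  then show ?case by (auto simp: hereditary_def)
qed

section \<open>Completeness, the Ramsey property and the link to derivatives\<close>

context
  fixes fs :: "omega1 \<Rightarrow> nat \<Rightarrow> omega1"
  assumes fs: "fundamental_sequences fs"
begin

lemma schreier_sectionE: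
  assumes "\<xi> \<noteq> 0"
  obtains f where "\<And>n. n \<ge> 1 \<Longrightarrow> f n < \<xi>"
    "\<And>n s. n \<ge> 1 \<Longrightarrow> s \<subseteq> {n<..} \<Longrightarrow> insert n s \<in> schreier fs \<xi> \<longleftrightarrow> s \<in> schreier fs (f n)"
    "\<And>\<eta>. \<eta> < \<xi> \<Longrightarrow> \<forall>\<^sub>F n in sequentially. \<eta> \<le> f n"
proof -
  from ex_schreier_section[OF fs assms] obtain f where
    "(\<forall>n\<ge>1. f n < \<xi> \<and> (\<forall>s\<subseteq>{n<..}. insert n s \<in> schreier fs \<xi> \<longleftrightarrow> s \<in> schreier fs (f n))) \<and>
      (\<forall>\<eta><\<xi>. \<forall>\<^sub>F n in sequentially. \<eta> \<le> f n)"
    by (elim exE)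
  then show thesis by (intro that[of f]) simp_all
qed

lemma schreier_decompose:
  assumes "s \<in> schreier fs \<xi>" "\<xi> \<noteq> 0"
    and f: "\<And>n s. n \<ge> 1 \<Longrightarrow> s \<subseteq> {n<..} \<Longrightarrow> insert n s \<in> schreier fs \<xi> \<longleftrightarrow> s \<in> schreier fs (f n)"
  obtains n t where "s = insert n t" "n \<ge> 1" "t \<subseteq> {n<..}" "t \<in> schreier fs (f n)" "finite t"
proof -
  have s: "finite s" "s \<noteq> {}" "s \<subseteq> {1..}"
    using schreier_finite[OF assms(1)] schreier_nonempty[OF assms(1,2)] schreier_pos[OF assms(1)] .
  define n t where "n = Min s" and "t = s - {n}"
  have "n \<in> s" using s by (simp add: n_def)
  then have "s = insert n t" by (auto simp: t_def)
  moreover have "n \<ge> 1" using \<open>n \<in> s\<close> s(3) by auto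
  moreover have "t \<subseteq> {n<..}"
  proof
    fix x assume "x \<in> t"
    then have "n \<le> x" "x \<noteq> n" using s(1) by (auto simp: n_def t_def)
    then show "x \<in> {n<..}" by simp
  qed
  moreover have "finite t" using s(1) by (simp add: t_def)
  ultimately show thesis using that f assms(1) by blast
qed

text \<open>Split off the minimum \<open>n\<close> of \<open>I\<close> and apply induction to the
  rest of \<open>I\<close> with the section index \<open>f n\<close>.\<close>

lemma schreier_complete:
  assumes "infinite I" "I \<subseteq> {1..}"
  shows "\<exists>s\<in>schreier fs \<xi>. init_seg s I"
  using assms
proof (induction \<xi> arbitrary: I rule: less_induct)
  case (less \<xi>)
  show ?case
  proof (cases "\<xi> = 0")
    case True
    then show ?thesis by (simp add: schreier_zero init_seg_def)
  next
    case False
    obtain f where f: "\<And>n. n \<ge> 1 \<Longrightarrow> f n < \<xi>"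
      "\<And>n s. n \<ge> 1 \<Longrightarrow> s \<subseteq> {n<..} \<Longrightarrow> insert n s \<in> schreier fs \<xi> \<longleftrightarrow> s \<in> schreier fs (f n)"
      by (rule schreier_sectionE[OF False]) (rule that)
    define n where "n = Inf I"
    have n: "n \<in> I" unfolding n_def using less.prems by (metis Inf_nat_def1 finite.emptyI)
    have le: "n \<le> x" if "x \<in> I" for x unfolding n_def using that by (rule wellorder_Inf_le1)
    have "n \<ge> 1" using n less.prems by auto
    moreover have "infinite (I \<inter> {n<..})" using less.prems by (simp add: infinite_Int_greaterThan)
    ultimately obtain s where s: "s \<in> schreier fs (f n)" "init_seg s (I \<inter> {n<..})"
      using less.IH[OF f(1), of n "I \<inter> {n<..}"] less.prems by blast
    then have "insert n s \<in> schreier fs \<xi>" using f(2)[of n s] \<open>n \<ge> 1\<close> by (auto simp: init_seg_def)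
    moreover have "init_seg (insert n s) I"
    proof -
      have "y \<in> insert n s" if x: "x \<in> insert n s" and y: "y \<in> I" "y < x" for x y
      proof (cases "y = n")
        case False
        then have "n < y" using le[OF y(1)] by simp
        then have "x \<in> s" using x y(2) by auto
        then show ?thesis using s(2) y \<open>n < y\<close> by (auto simp: init_seg_def)
      qed simp
      then show ?thesis using s(2) n by (auto simp: init_seg_def)
    qed
    ultimately show ?thesis by blast
  qed
qed

text \<open>Completeness is applied to \<open>t\<close> followed by the part of \<open>L\<close>
  above \<open>t\<close>. Both \<open>t\<close> and the member found are initial segments of that
  set, hence comparable. For empty \<open>t\<close> this yields a member inside
  \<open>L\<close>.\<close>

lemma schreier_compare:
  assumes L: "infinite L" "L \<subseteq> {1..}" and t: "t \<in> Fpow L"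
  shows "\<exists>s\<in>schreier fs \<xi> \<inter> Fpow L. init_seg t s \<or> init_seg s t"
proof -
  define I where "I = t \<union> {x \<in> L. \<forall>y\<in>t. y < x}"
  have "infinite I" using infinite_greater[OF L(1)] t by (simp add: I_def Fpow_def)
  moreover have "I \<subseteq> L" using t by (auto simp: I_def Fpow_def)
  ultimately obtain s where s: "s \<in> schreier fs \<xi>" "init_seg s I"
    using schreier_complete[of I] L by blast
  have sub: "s \<subseteq> I" and init: "\<And>x y. x \<in> s \<Longrightarrow> y \<in> I \<Longrightarrow> y < x \<Longrightarrow> y \<in> s"
    using s(2) by (auto simp: init_seg_def)
  have "init_seg t s \<or> init_seg s t"
  proof (cases "t \<subseteq> s")
    case True
    then have "init_seg t s" using sub by (auto simp: init_seg_def I_def dest: order_less_asym)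
    then show ?thesis ..
  next
    case False
    then obtain x where x: "x \<in> t" "x \<notin> s" by blast
    have "y \<in> t" if "y \<in> s" for y
    proof (rule ccontr)
      assume "y \<notin> t"
      then have "x < y" using that sub x by (auto simp: I_def)
      then show False using init[OF that, of x] x by (simp add: I_def)
    qed
    moreover have "y \<in> s" if "x \<in> s" "y \<in> t" "y < x" for x y
      using init[OF that(1) _ that(3)] that(2) by (simp add: I_def)
    ultimately have "init_seg s t" unfolding init_seg_def by blast
    then show ?thesis ..
  qed
  moreover have "s \<in> Fpow L"
    using s(1) sub \<open>I \<subseteq> L\<close> schreier_finite by (auto simp: Fpow_def)
  ultimately show ?thesis using s(1) by blast
qed

text \<open>By induction and diagonalization, the colour of a member inside \<open>L\<close> depends
  only on its minimum. One of the two classes of minima is infinite.\<close>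

lemma schreier_ramsey:
  assumes "infinite I"
  shows "\<exists>L\<subseteq>I. infinite L \<and> (schreier fs \<xi> \<inter> Fpow L \<subseteq> \<F> \<or> schreier fs \<xi> \<inter> Fpow L \<inter> \<F> = {})"
  using assms
proof (induction \<xi> arbitrary: I \<F> rule: less_induct)
  case (less \<xi>)
  show ?case
  proof (cases "\<xi> = 0")
    case True
    then show ?thesis using less.prems by (intro exI[of _ I]) (auto simp: schreier_zero)
  next
    case False
    obtain f where f: "\<And>n. n \<ge> 1 \<Longrightarrow> f n < \<xi>"
      "\<And>n s. n \<ge> 1 \<Longrightarrow> s \<subseteq> {n<..} \<Longrightarrow> insert n s \<in> schreier fs \<xi> \<longleftrightarrow> s \<in> schreier fs (f n)"
      by (rule schreier_sectionE[OF False]) (rule that)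
    define P where "P n K \<longleftrightarrow> (\<forall>s\<in>schreier fs (f n) \<inter> Fpow K. insert n s \<in> \<F>) \<or>
        (\<forall>s\<in>schreier fs (f n) \<inter> Fpow K. insert n s \<notin> \<F>)" for n K
    have "\<exists>L\<subseteq>I \<inter> {1..}. infinite L \<and> (\<forall>n\<in>L. P n (L \<inter> {n<..}))"
    proof (rule diagonalization)
      show "infinite (I \<inter> {1..})"
        using infinite_Int_greaterThan[OF less.prems, of 0] by (simp add: greaterThan_def atLeast_def Suc_le_eq)
      fix n J assume "n \<in> I \<inter> {1..}" "J \<subseteq> I \<inter> {1..}" "infinite J"
      then obtain K where "K \<subseteq> J" "infinite K" "schreier fs (f n) \<inter> Fpow K \<subseteq> {s. insert n s \<in> \<F>} \<or>
          schreier fs (f n) \<inter> Fpow K \<inter> {s. insert n s \<in> \<F>} = {}"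
        using less.IH[OF f(1), of n J "{s. insert n s \<in> \<F>}"] by auto
      then show "\<exists>K\<subseteq>J. infinite K \<and> P n K" unfolding P_def by blast
    next
      fix n J K assume "P n J" "K \<subseteq> J"
      moreover from this have "Fpow K \<subseteq> Fpow J" by (simp add: Fpow_mono)
      ultimately show "P n K" unfolding P_def by blast
    qed
    then obtain L where L: "L \<subseteq> I" "infinite L" "\<And>n. n \<in> L \<Longrightarrow> P n (L \<inter> {n<..})" by blast
    \<comment> \<open>The minima whose members all fall into \<open>\<F>\<close>; for the other
      points of \<open>L\<close>, \<open>P\<close> says that no such member does.\<close>
    define C where "C = {n \<in> L. \<forall>s\<in>schreier fs (f n) \<inter> Fpow (L \<inter> {n<..}). insert n s \<in> \<F>}"
    have dec: "\<exists>n t. s = insert n t \<and> n \<in> K \<and> t \<in> schreier fs (f n) \<inter> Fpow (L \<inter> {n<..})"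
      if s: "s \<in> schreier fs \<xi> \<inter> Fpow K" "K \<subseteq> L" for s K
    proof -
      obtain n t where nt: "s = insert n t" "n \<ge> 1" "t \<subseteq> {n<..}" "t \<in> schreier fs (f n)" "finite t"
        using schreier_decompose[of s \<xi> f] s f(2) False by blast
      then have "n \<in> K" "t \<in> Fpow (L \<inter> {n<..})" using s by (auto simp: Fpow_def)
      with nt show ?thesis by blast
    qed
    show ?thesis
    proof (cases "finite C")
      case False
      have "schreier fs \<xi> \<inter> Fpow C \<subseteq> \<F>"
      proof
        fix s assume "s \<in> schreier fs \<xi> \<inter> Fpow C"
        then obtain n t where "s = insert n t" "n \<in> C" "t \<in> schreier fs (f n) \<inter> Fpow (L \<inter> {n<..})"
          using dec[of s C] by (auto simp: C_def)
        then show "s \<in> \<F>" by (simp add: C_def)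
      qed
      moreover have "C \<subseteq> I" using L by (auto simp: C_def)
      ultimately show ?thesis using False by blast
    next
      case True
      have "s \<notin> \<F>" if s: "s \<in> schreier fs \<xi> \<inter> Fpow (L - C)" for s
      proof -
        obtain n t where nt: "s = insert n t" "n \<in> L - C" "t \<in> schreier fs (f n) \<inter> Fpow (L \<inter> {n<..})"
          using dec[OF s Diff_subset] by (elim exE conjE) (rule that)
        then have "\<forall>s\<in>schreier fs (f n) \<inter> Fpow (L \<inter> {n<..}). insert n s \<notin> \<F>"
          using L(3)[of n] unfolding P_def C_def by blast
        with nt show ?thesis by blast
      qed
      moreover have "infinite (L - C)" using True L(2) by simp
      ultimately show ?thesis using L(1) by (intro exI[of _ "L - C"]) blast
    qed
  qed
qed

text \<open>For almost all \<open>n\<close> in \<open>L\<close> the set \<open>insert n F\<close>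
  survives \<xi> derivations. Induction with the section index \<open>f n\<close> treats members of
  minimum \<open>n\<close>, and diagonalization combines the resulting sets.\<close>

lemma schreier_subset_if_cb_deriv:
  assumes "infinite L" "L \<subseteq> {1..}" "F \<in> cb_deriv G L (osuc \<xi>)"
  shows "\<exists>K\<subseteq>L. infinite K \<and> (\<forall>s\<in>schreier fs \<xi> \<inter> Fpow K. F \<union> s \<in> G)"
  using assms
proof (induction \<xi> arbitrary: F L rule: less_induct)
  case (less \<xi>)
  show ?case
  proof (cases "\<xi> = 0")
    case True
    then show ?thesis
      using less.prems subsetD[OF cb_deriv_subset less.prems(3)] by (intro exI[of _ L]) (auto simp: schreier_zero)
  next
    case False
    obtain f where f: "\<And>n. n \<ge> 1 \<Longrightarrow> f n < \<xi>"
      "\<And>n s. n \<ge> 1 \<Longrightarrow> s \<subseteq> {n<..} \<Longrightarrow> insert n s \<in> schreier fs \<xi> \<longleftrightarrow> s \<in> schreier fs (f n)"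
      by (rule schreier_sectionE[OF False]) (rule that)
    define I where "I = {n \<in> L. insert n F \<in> cb_deriv G L \<xi>}"
    have "L - I = {n \<in> L. insert n F \<notin> cb_deriv G L \<xi>}" by (auto simp: I_def)
    then have "finite (L - I)" using less.prems(3) by (simp add: cb_deriv_osuc)
    then have "infinite I" using less.prems(1) finite_Diff2 by blast
    have "\<exists>K\<subseteq>I. infinite K \<and> (\<forall>n\<in>K. \<forall>s\<in>schreier fs (f n) \<inter> Fpow (K \<inter> {n<..}). insert n F \<union> s \<in> G)"
    proof (rule diagonalization[OF \<open>infinite I\<close>])
      fix n J assume n: "n \<in> I" and J: "J \<subseteq> I" "infinite J"
      have "n \<ge> 1" using n less.prems(2) by (auto simp: I_def)
      have JL: "J \<subseteq> L" using J by (auto simp: I_def)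
      \<comment> \<open>From \<open>f n < \<xi>\<close> follows
        \<open>osuc (f n) \<le> \<xi>\<close>. This is how the one extra derivation is carried
        through the induction.\<close>
      have "insert n F \<in> cb_deriv G L (osuc (f n))"
        using n f(1)[OF \<open>n \<ge> 1\<close>] cb_deriv_antimono[of "osuc (f n)" \<xi> G L] by (auto simp: I_def osuc_le_iff)
      then have "insert n F \<in> cb_deriv G J (osuc (f n))"
        using cb_deriv_almost_mono[of J L G] JL by (metis Diff_eq_empty_iff finite.emptyI subsetD)
      then show "\<exists>K\<subseteq>J. infinite K \<and> (\<forall>s\<in>schreier fs (f n) \<inter> Fpow K. insert n F \<union> s \<in> G)"
        using less.IH[OF f(1)[OF \<open>n \<ge> 1\<close>] J(2)] JL less.prems(2) by blast
    next
      fix n J K assume "\<forall>s\<in>schreier fs (f n) \<inter> Fpow J. insert n F \<union> s \<in> G" "K \<subseteq> (J :: nat set)"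
      moreover from this have "Fpow K \<subseteq> Fpow J" by (simp add: Fpow_mono)
      ultimately show "\<forall>s\<in>schreier fs (f n) \<inter> Fpow K. insert n F \<union> s \<in> G" by blast
    qed
    then obtain K where K: "K \<subseteq> I" "infinite K"
      "\<And>n s. n \<in> K \<Longrightarrow> s \<in> schreier fs (f n) \<Longrightarrow> s \<in> Fpow (K \<inter> {n<..}) \<Longrightarrow> insert n F \<union> s \<in> G"
      by blast
    have "F \<union> s \<in> G" if s: "s \<in> schreier fs \<xi> \<inter> Fpow K" for s
    proof -
      obtain n t where nt: "s = insert n t" "n \<ge> 1" "t \<subseteq> {n<..}" "t \<in> schreier fs (f n)" "finite t"
        using schreier_decompose[of s \<xi> f] s f(2) False by blast
      then have "insert n F \<union> t \<in> G" using s by (intro K(3)) (auto simp: Fpow_def)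
      with nt(1) show ?thesis by simp
    qed
    moreover have "K \<subseteq> L" using K(1) by (auto simp: I_def)
    ultimately show ?thesis using K(2) by blast
  qed
qed

text \<open>For \<eta> below \<xi>, almost all \<open>n\<close> satisfy
  \<open>\<eta> \<le> f n\<close>. Induction on \<open>L\<close> above \<open>n\<close> puts
  \<open>insert n F\<close> into the derivative of order \<open>f n\<close>, hence into that of
  order \<eta>.\<close>

lemma cb_deriv_if_schreier_subset:
  assumes "infinite L" "L \<subseteq> {1..}" "hereditary G" "\<And>s. s \<in> schreier fs \<xi> \<inter> Fpow L \<Longrightarrow> F \<union> s \<in> G"
  shows "F \<in> cb_deriv G L \<xi>"
  using assms
proof (induction \<xi> arbitrary: F L rule: less_induct)
  case (less \<xi>)
  obtain s where "s \<in> schreier fs \<xi> \<inter> Fpow L"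
    using schreier_compare[OF less.prems(1,2), of "{}"] by (auto simp: Fpow_def)
  then have "F \<in> G" using less.prems(4) hereditaryD[OF less.prems(3)] by blast
  moreover have "finite {n \<in> L. insert n F \<notin> cb_deriv G L \<eta>}" if \<eta>: "\<eta> < \<xi>" for \<eta>
  proof -
    have "\<xi> \<noteq> 0" using \<eta> by (auto simp: leD)
    obtain f where f: "\<And>n. n \<ge> 1 \<Longrightarrow> f n < \<xi>"
      "\<And>n s. n \<ge> 1 \<Longrightarrow> s \<subseteq> {n<..} \<Longrightarrow> insert n s \<in> schreier fs \<xi> \<longleftrightarrow> s \<in> schreier fs (f n)"
      "\<And>\<eta>. \<eta> < \<xi> \<Longrightarrow> \<forall>\<^sub>F n in sequentially. \<eta> \<le> f n"
      by (rule schreier_sectionE[OF \<open>\<xi> \<noteq> 0\<close>]) (rule that)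
    obtain N where N: "\<And>n. n \<ge> N \<Longrightarrow> \<eta> \<le> f n" using f(3)[OF \<eta>] by (auto simp: eventually_sequentially)
    have "insert n F \<in> cb_deriv G L \<eta>" if n: "n \<in> L" "n \<ge> N" for n
    proof -
      have "n \<ge> 1" using n less.prems(2) by auto
      have "insert n F \<in> cb_deriv G (L \<inter> {n<..}) (f n)"
      proof (rule less.IH[OF f(1)[OF \<open>n \<ge> 1\<close>] _ _ less.prems(3)])
        show "infinite (L \<inter> {n<..})" using less.prems(1) by (rule infinite_Int_greaterThan)
        show "L \<inter> {n<..} \<subseteq> {1..}" using less.prems(2) by blast
        fix t assume t: "t \<in> schreier fs (f n) \<inter> Fpow (L \<inter> {n<..})"
        then have "insert n t \<in> schreier fs \<xi>" using f(2)[OF \<open>n \<ge> 1\<close>, of t] by (auto simp: Fpow_def)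
        then have "F \<union> insert n t \<in> G" using t n by (intro less.prems(4)) (auto simp: Fpow_def)
        then show "insert n F \<union> t \<in> G" by simp
      qed
      \<comment> \<open>Restoring the finitely many points of \<open>L\<close> up to
        \<open>n\<close> keeps \<open>insert n F\<close> in the derivative.\<close>
      moreover have "finite (L - (L \<inter> {n<..}))" by (rule finite_subset[of _ "{..n}"]) auto
      ultimately have "insert n F \<in> cb_deriv G L (f n)" using cb_deriv_almost_mono by blast
      then show ?thesis using cb_deriv_antimono[OF N[OF n(2)]] by blast
    qed
    then have "{n \<in> L. insert n F \<notin> cb_deriv G L \<eta>} \<subseteq> {..<N}" by (auto simp: not_le[symmetric])
    then show ?thesis by (rule finite_subset) simp
  qed
  ultimately show ?case by (simp add: cb_deriv_iff[of F])
qed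

text \<open>
  If no such \<open>K\<close> existed, by Ramsey's theorem every member of the Schreier family in some
  \<open>Fpow K\<close> would have a subset outside \<open>\<F>\<close>. But all subsets of a member of least cardinality
  are initial segments of members.
\<close>

lemma ex_schreier_all_subsets:
  assumes L: "infinite L" "L \<subseteq> {1..}" "schreier fs \<xi> \<inter> Fpow L \<subseteq> \<F>"
    and tree: "\<And>s t. s \<in> \<F> \<Longrightarrow> init_seg t s \<Longrightarrow> t \<in> \<F>"
  shows "\<exists>K\<subseteq>L. infinite K \<and> (\<forall>s\<in>schreier fs \<xi> \<inter> Fpow K. \<forall>t\<subseteq>s. t \<in> \<F>)"
proof -
  obtain K where K: "K \<subseteq> L" "infinite K"
    and cases: "schreier fs \<xi> \<inter> Fpow K \<subseteq> {s. \<forall>t\<subseteq>s. t \<in> \<F>} \<or>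
      schreier fs \<xi> \<inter> Fpow K \<inter> {s. \<forall>t\<subseteq>s. t \<in> \<F>} = {}"
    using schreier_ramsey[OF L(1), of \<xi> "{s. \<forall>t\<subseteq>s. t \<in> \<F>}"] by blast
  have "\<not> schreier fs \<xi> \<inter> Fpow K \<inter> {s. \<forall>t\<subseteq>s. t \<in> \<F>} = {}"
  proof
    assume none: "schreier fs \<xi> \<inter> Fpow K \<inter> {s. \<forall>t\<subseteq>s. t \<in> \<F>} = {}"
    have K1: "K \<subseteq> {1..}" using K L by blast
    have "\<exists>s. s \<in> schreier fs \<xi> \<inter> Fpow K"
      using schreier_compare[OF K(2) K1, of "{}"] by (auto simp: Fpow_def)
    then obtain s where s: "s \<in> schreier fs \<xi> \<inter> Fpow K"
      and min: "\<And>u. u \<in> schreier fs \<xi> \<inter> Fpow K \<Longrightarrow> card s \<le> card u"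
      using ex_has_least_nat[of "\<lambda>s. s \<in> schreier fs \<xi> \<inter> Fpow K" _ card] by metis
    then obtain t where t: "t \<subseteq> s" "t \<notin> \<F>" using none by blast
    then have "t \<in> Fpow K" using s by (auto simp: Fpow_def intro: finite_subset)
    then obtain u where u: "u \<in> schreier fs \<xi> \<inter> Fpow K" "init_seg t u \<or> init_seg u t"
      using schreier_compare[OF K(2) K1] by blast
    have "Fpow K \<subseteq> Fpow L" using K(1) by (rule Fpow_mono)
    then have "u \<in> \<F>" using u(1) L(3) by blast
    from u(2) show False
    proof
      assume "init_seg t u"
      then show False using tree \<open>u \<in> \<F>\<close> t by blast
    next
      assume "init_seg u t"
      then have "u \<subseteq> t" by (simp add: init_seg_def)
      moreover have "finite s" using s by (simp add: Fpow_def)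
      ultimately have "u = s" using min[OF u(1)] t(1) by (metis card_seteq subset_trans)
      then show False using \<open>u \<subseteq> t\<close> t \<open>u \<in> \<F>\<close> by auto
    qed
  qed
  with cases have "schreier fs \<xi> \<inter> Fpow K \<subseteq> {s. \<forall>t\<subseteq>s. t \<in> \<F>}" by argo
  then have "\<forall>t\<subseteq>s. t \<in> \<F>" if "s \<in> schreier fs \<xi> \<inter> Fpow K" for s
    using that by (rule CollectD[OF subsetD])
  then show ?thesis using K by (intro exI[of _ K] conjI ballI) assumption+
qed

end

section \<open>Derivatives of hereditary families\<close>

lemma open_supersets: "finite F \<Longrightarrow> open {g :: nat \<Rightarrow> bool. \<forall>i\<in>F. g i}"
proof -
  assume "finite F"
  have "{g. \<forall>i\<in>F. g i} = (\<Inter>i\<in>F. (\<lambda>g :: nat \<Rightarrow> bool. g i) -` {True})" by auto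
  moreover have "open ((\<lambda>g :: nat \<Rightarrow> bool. g i) -` {True})" for i
    by (intro open_vimage open_discrete continuous_on_product_coordinates)
  ultimately show ?thesis using \<open>finite F\<close> by auto
qed

lemma tendsto_charf:
  assumes "\<And>i. \<forall>\<^sub>F k in sequentially. i \<in> S k \<longleftrightarrow> i \<in> U"
  shows "(\<lambda>k. charf (S k)) \<longlonglongrightarrow> charf U"
proof -
  have "(\<lambda>k. charf (S k) i) \<longlonglongrightarrow> charf U i" for i
    using assms[of i] by (intro tendsto_eventually) (simp add: charf_def)
  then show ?thesis
    using limitin_componentwise[of "\<lambda>_. euclidean" UNIV "\<lambda>k. charf (S k)" "charf U" sequentially]
    by (simp add: euclidean_product_topology)
qed

text \<open>If infinitely many \<open>n\<close> fail, take them as the set \<open>I\<close>: a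
  member strictly between \<open>F\<close> and \<open>F \<union> I\<close>, or equal to the latter,
  contains a failing \<open>n\<close>, and heredity yields \<open>insert n F\<close> in
  \<open>X\<close>. Conversely, the sets \<open>insert n F\<close> with \<open>n\<close> in
  \<open>I\<close> converge to \<open>F\<close>.\<close>

lemma scb_deriv_hereditary:
  assumes her: "hereditary X" and fin: "X \<subseteq> Fpow UNIV" and L: "infinite L"
  shows "F \<in> scb_deriv L X \<longleftrightarrow> F \<in> X \<and> F \<subseteq> L \<and> finite {n \<in> L. insert n F \<notin> X}"
proof
  assume F: "F \<in> scb_deriv L X"
  then have FX: "F \<in> X" "F \<subseteq> L" "finite F" by (auto simp: scb_deriv_def Fpow_def)
  have "finite {n \<in> L. insert n F \<notin> X}"
  proof (rule ccontr)
    define N where "N = {n \<in> L. insert n F \<notin> X}"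
    assume "infinite {n \<in> L. insert n F \<notin> X}"
    then have "N \<in> infsets L" by (auto simp: N_def infsets_def)
    then have "charf F islimpt charf ` (X \<inter> Fpow (F \<union> N))" using F by (simp add: scb_deriv_def)
    then obtain g where "g \<in> charf ` (X \<inter> Fpow (F \<union> N))" "\<forall>i\<in>F. g i" "g \<noteq> charf F"
      using open_supersets[OF FX(3)] by (auto simp: charf_def elim!: islimptE[where T = "{g. \<forall>i\<in>F. g i}"])
    then obtain F' where F': "F' \<in> X" "F' \<subseteq> F \<union> N" "F \<subseteq> F'" "F' \<noteq> F"
      by (auto simp: charf_def Fpow_def)
    then obtain n where n: "n \<in> F'" "n \<in> N" by blast
    then have "insert n F \<in> X" using F' hereditaryD[OF her F'(1)] by blast
    with n show False by (simp add: N_def)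
  qed
  with FX show "F \<in> X \<and> F \<subseteq> L \<and> finite {n \<in> L. insert n F \<notin> X}" by blast
next
  assume F: "F \<in> X \<and> F \<subseteq> L \<and> finite {n \<in> L. insert n F \<notin> X}"
  then have "finite F" using fin by (auto simp: Fpow_def)
  have "charf F islimpt charf ` (X \<inter> Fpow (F \<union> I))" if "I \<in> infsets L" for I
  proof (rule islimptI)
    fix T assume T: "charf F \<in> T" "open T"
    have I: "I \<subseteq> L" "infinite I" using that by (auto simp: infsets_def)
    define e where "e = enumerate I"
    have eI: "e k \<in> I" "k \<le> e k" for k
      using enumerate_in_set[OF I(2)] le_enumerate[OF I(2)] by (auto simp: e_def)
    have "\<forall>\<^sub>F k in sequentially. i \<in> insert (e k) F \<longleftrightarrow> i \<in> F" for i
    proof -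
      have "i \<in> insert (e k) F \<longleftrightarrow> i \<in> F" if "k \<ge> Suc i" for k
        using eI(2)[of k] that by auto
      then show ?thesis unfolding eventually_sequentially by blast
    qed
    then have "(\<lambda>k. charf (insert (e k) F)) \<longlonglongrightarrow> charf F" by (rule tendsto_charf)
    then have "\<forall>\<^sub>F k in sequentially. charf (insert (e k) F) \<in> T"
      using T by (intro topological_tendstoD)
    then obtain k\<^sub>0 where k\<^sub>0: "\<And>k. k \<ge> k\<^sub>0 \<Longrightarrow> charf (insert (e k) F) \<in> T"
      by (auto simp: eventually_sequentially)
    \<comment> \<open>The points of \<open>L\<close> to avoid. An element of \<open>I\<close>
      enumerated late enough lies outside \<open>B\<close> and puts \<open>insert n F\<close> into
      the neighbourhood \<open>T\<close>.\<close>
    define B where "B = F \<union> {n \<in> L. insert n F \<notin> X}"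
    have "finite B" using F \<open>finite F\<close> by (simp add: B_def)
    then obtain b where b: "\<And>x. x \<in> B \<Longrightarrow> x \<le> b" by (auto simp: finite_nat_set_iff_bounded_le)
    define n where "n = e (max k\<^sub>0 (Suc b))"
    have "n \<notin> B" using b[of n] eI(2)[of "max k\<^sub>0 (Suc b)"] by (auto simp: n_def)
    moreover have "n \<in> I" using eI by (simp add: n_def)
    ultimately have "insert n F \<in> X \<inter> Fpow (F \<union> I)" "n \<notin> F"
      using I(1) \<open>finite F\<close> by (auto simp: B_def Fpow_def)
    moreover have "charf (insert n F) \<in> T" using k\<^sub>0 by (simp add: n_def)
    moreover have "charf (insert n F) \<noteq> charf F" using \<open>n \<notin> F\<close> by (auto simp: charf_def fun_eq_iff)
    ultimately show "\<exists>y\<in>charf ` (X \<inter> Fpow (F \<union> I)). y \<in> T \<and> y \<noteq> charf F" by blast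
  qed
  with F \<open>finite F\<close> show "F \<in> scb_deriv L X" by (auto simp: scb_deriv_def Fpow_def)
qed

text \<open>Index 0 is separate because \<open>scb L G 0\<close> is not yet restricted to subsets of
  \<open>L\<close>; the first derivation introduces this restriction.\<close>

lemma scb_eq_cb_deriv:
  assumes her: "hereditary G" and fin: "G \<subseteq> Fpow UNIV" and L: "infinite L"
  shows "scb L G \<xi> = (if \<xi> = 0 then G else cb_deriv G L \<xi> \<inter> Fpow L)"
proof (induction \<xi> rule: omega1_induct)
  case zero
  then show ?case by (simp add: scb_zero)
next
  case (osuc \<xi>)
  define X where "X = scb L G \<xi>"
  have X: "X = (if \<xi> = 0 then G else cb_deriv G L \<xi> \<inter> Fpow L)" by (simp add: X_def osuc)
  have "hereditary (cb_deriv G L \<xi> \<inter> Fpow L)"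
    using hereditary_cb_deriv[OF her, of L \<xi>] by (auto simp: hereditary_def Fpow_def intro: finite_subset)
  then have herX: "hereditary X" using her by (simp add: X)
  have finX: "X \<subseteq> Fpow UNIV" using fin cb_deriv_subset[of G L \<xi>] by (auto simp: X)
  have mem: "F \<in> X \<longleftrightarrow> F \<in> cb_deriv G L \<xi>" if "F \<subseteq> L" for F
    using that fin cb_deriv_subset[of G L \<xi>] cb_deriv_zero[of G L] by (auto simp: X Fpow_def)
  have "F \<in> scb_deriv L X \<longleftrightarrow> F \<in> cb_deriv G L (osuc \<xi>) \<inter> Fpow L" for F
  proof (cases "F \<subseteq> L")
    case True
    then have "{n \<in> L. insert n F \<notin> X} = {n \<in> L. insert n F \<notin> cb_deriv G L \<xi>}"
      using mem by auto
    moreover have "F \<in> cb_deriv G L \<xi> \<Longrightarrow> F \<in> Fpow L"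
      using True fin cb_deriv_subset[of G L \<xi>] by (auto simp: Fpow_def)
    ultimately show ?thesis
      using True mem[OF True] by (auto simp: scb_deriv_hereditary[OF herX finX L] cb_deriv_osuc)
  next
    case False
    then show ?thesis by (auto simp: scb_deriv_hereditary[OF herX finX L] Fpow_def)
  qed
  moreover have "scb L G (osuc \<xi>) = scb_deriv L X"
    using scb_plus_one[of L G \<xi>] by (simp add: X_def plus_omega1_one)
  ultimately show ?case by auto
next
  case (lim \<xi>)
  have one: "1 < \<xi>" using osuc_less_olim[OF lim(1) is_olim_pos[OF lim(1)]] by (simp add: one_omega1_def)
  have "scb L G \<xi> = (\<Inter>\<beta>\<in>{1..<\<xi>}. cb_deriv G L \<beta> \<inter> Fpow L)"
    unfolding scb_lim[OF lim(1)] by (intro INF_cong) (use lim one_le_omega1_iff in auto)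
  also have "\<dots> = cb_deriv G L \<xi> \<inter> Fpow L"
  proof (rule set_eqI)
    fix F
    have "F \<in> cb_deriv G L \<xi> \<longleftrightarrow> (\<forall>\<beta>\<in>{1..<\<xi>}. F \<in> cb_deriv G L \<beta>)"
    proof
      assume F: "\<forall>\<beta>\<in>{1..<\<xi>}. F \<in> cb_deriv G L \<beta>"
      have "F \<in> cb_deriv G L \<beta>" if "\<beta> < \<xi>" for \<beta>
      proof (cases "1 \<le> \<beta>")
        case True
        then show ?thesis using F that by simp
      next
        case False
        then have "\<beta> \<le> 1" by simp
        moreover have "F \<in> cb_deriv G L 1" using F one by simp
        ultimately show ?thesis using cb_deriv_antimono by blast
      qed
      then show "F \<in> cb_deriv G L \<xi>" by (simp add: cb_deriv_lim[OF lim(1)])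
    qed (simp add: cb_deriv_lim[OF lim(1)])
    moreover have "1 \<in> {1..<\<xi>}" using one by simp
    ultimately show "F \<in> (\<Inter>\<beta>\<in>{1..<\<xi>}. cb_deriv G L \<beta> \<inter> Fpow L) \<longleftrightarrow> F \<in> cb_deriv G L \<xi> \<inter> Fpow L"
      by blast
  qed
  finally have "scb L G \<xi> = cb_deriv G L \<xi> \<inter> Fpow L" .
  moreover have "\<xi> \<noteq> 0" using lim(1) by auto
  ultimately show ?case by (simp only: if_False)
qed

text \<open>The finite initial parts of \<open>U\<close> converge to \<open>U\<close>, so closedness
  would put the infinite set \<open>U\<close> itself into \<open>G\<close>.\<close>

lemma pw_closed_no_infinite:
  assumes closed: "pw_closed G" and fin: "G \<subseteq> Fpow UNIV" and U: "infinite U"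
  shows "\<not> Fpow U \<subseteq> G"
proof
  assume sub: "Fpow U \<subseteq> G"
  have "\<forall>\<^sub>F k in sequentially. i \<in> U \<inter> {..k} \<longleftrightarrow> i \<in> U" for i
    unfolding eventually_sequentially by (intro exI[of _ i]) auto
  then have "(\<lambda>k. charf (U \<inter> {..k})) \<longlonglongrightarrow> charf U" by (rule tendsto_charf)
  moreover have "U \<inter> {..k} \<in> G" for k using sub by (auto simp: Fpow_def)
  ultimately have "charf U \<in> charf ` G"
    using closed unfolding pw_closed_def
    by (intro Lim_in_closed_set[of "charf ` G" "\<lambda>k. charf (U \<inter> {..k})" sequentially] always_eventually) auto
  then obtain V where "V \<in> G" "charf U = charf V" by blast
  then have "U \<in> G" by (auto simp: charf_def fun_eq_iff set_eq_iff[symmetric])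
  then show False using fin U by (auto simp: Fpow_def)
qed

text \<open>A limit point outside the family is the characteristic function of some
  \<open>U\<close>. Each finite part of \<open>U\<close> is contained in a nearby member, so
  heredity applies; a finite \<open>U\<close> would itself be a member.\<close>

lemma not_pw_closed_infinite:
  assumes nclosed: "\<not> pw_closed G" and her: "hereditary G" and GM: "G \<subseteq> Fpow M"
  shows "\<exists>U\<in>infsets M. Fpow U \<subseteq> G"
proof -
  obtain x where x: "x islimpt charf ` G" "x \<notin> charf ` G"
    using nclosed unfolding pw_closed_def closed_limpt by blast
  define U where "U = {i. x i}"
  have "charf U = x" by (simp add: charf_def U_def)
  have sub: "T \<in> G" if T: "finite T" "T \<subseteq> U" for T
  proof -
    have "x \<in> {g. \<forall>i\<in>T. g i}" using T by (auto simp: U_def)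
    then obtain g where "g \<in> charf ` G" "\<forall>i\<in>T. g i"
      using x(1) open_supersets[OF T(1)] by (auto elim!: islimptE[where T = "{g. \<forall>i\<in>T. g i}"])
    then obtain s where "s \<in> G" "T \<subseteq> s" by (auto simp: charf_def)
    then show ?thesis using hereditaryD[OF her] by blast
  qed
  have "infinite U" using sub[of U] x(2) \<open>charf U = x\<close> by blast
  moreover have "U \<subseteq> M"
  proof
    fix i assume "i \<in> U"
    then have "{i} \<in> G" using sub[of "{i}"] by simp
    then show "i \<in> M" using GM by (auto simp: Fpow_def)
  qed
  ultimately show ?thesis using sub by (intro bexI[of _ U]) (auto simp: infsets_def Fpow_def)
qed

text \<open>Chains in \<open>G\<close> cannot increase forever, since every finite subset of the
  union would lie in \<open>G\<close>. Well-founded induction along proper extensions then gives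
  each \<open>F\<close> a rank, uniform in \<open>L\<close>, at which it has left the
  derivatives.\<close>

lemma cb_deriv_bound:
  assumes her: "hereditary G" and fin: "G \<subseteq> Fpow UNIV"
    and noinf: "\<And>U. infinite U \<Longrightarrow> \<not> Fpow U \<subseteq> G"
  shows "\<exists>\<xi>. \<forall>L. infinite L \<longrightarrow> cb_deriv G L \<xi> = {}"
proof -
  let ?R = "{(F', F). F \<in> G \<and> F' \<in> G \<and> F \<subset> F'}"
  have "wf ?R"
    unfolding wf_iff_no_infinite_down_chain
  proof
    assume "\<exists>S. \<forall>i. (S (Suc i), S i) \<in> ?R"
    then obtain S where "\<forall>i. (S (Suc i), S i) \<in> ?R" by blast
    then have S: "\<And>i. S i \<in> G" "\<And>i. S i \<subset> S (Suc i)" by auto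
    define U where "U = (\<Union>i. S i)"
    have mono: "S i \<subseteq> S j" if "i \<le> j" for i j
      by (rule lift_Suc_mono_le[OF _ that]) (use S(2) in blast)
    have cover: "\<exists>i. T \<subseteq> S i" if "finite T" "T \<subseteq> U" for T
      using that
    proof (induction T)
      case (insert x T)
      then obtain i j where "T \<subseteq> S i" "x \<in> S j" by (auto simp: U_def)
      then have "insert x T \<subseteq> S (max i j)" using mono[of i "max i j"] mono[of j "max i j"] by auto
      then show ?case ..
    qed simp
    have "infinite U"
    proof
      assume "finite U"
      then obtain i where "U \<subseteq> S i" using cover by blast
      then show False using S(2)[of i] by (auto simp: U_def)
    qed
    moreover have "Fpow U \<subseteq> G"
      using cover S(1) hereditaryD[OF her] by (auto simp: Fpow_def) blast
    ultimately show False using noinf by blast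
  qed
  then have "\<exists>\<xi>. \<forall>L. infinite L \<longrightarrow> F \<notin> cb_deriv G L \<xi>" for F
  proof (induction F rule: wf_induct_rule)
    case (less F)
    show ?case
    proof (cases "F \<in> G")
      case False
      then show ?thesis using cb_deriv_subset by blast
    next
      case True
      have "\<exists>\<xi>. n \<notin> F \<longrightarrow> insert n F \<in> G \<longrightarrow> (\<forall>L. infinite L \<longrightarrow> insert n F \<notin> cb_deriv G L \<xi>)" for n
        using less[of "insert n F"] True by blast
      then obtain g where g: "\<And>n L. n \<notin> F \<Longrightarrow> insert n F \<in> G \<Longrightarrow> infinite L \<Longrightarrow> insert n F \<notin> cb_deriv G L (g n)"
        by metis
      \<comment> \<open>There are only countably many one-point extensions, so their ranks have a
        countable bound.\<close>
      have "bdd_above (range g)" by (rule bdd_above_countable_omega1) simp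
      then obtain \<xi> where \<xi>: "\<And>n. g n \<le> \<xi>" by (auto simp: bdd_above_def)
      have "F \<notin> cb_deriv G L (osuc \<xi>)" if L: "infinite L" for L
      proof
        assume "F \<in> cb_deriv G L (osuc \<xi>)"
        then have "finite {n \<in> L. insert n F \<notin> cb_deriv G L \<xi>}" by (simp add: cb_deriv_osuc)
        moreover have "finite F" using True fin by (auto simp: Fpow_def)
        \<comment> \<open>An infinite \<open>L\<close> supplies a proper extension of
          \<open>F\<close> still present at stage \<xi>, against its rank.\<close>
        ultimately have "\<not> L \<subseteq> F \<union> {n \<in> L. insert n F \<notin> cb_deriv G L \<xi>}"
          using L by (meson finite_Un finite_subset)
        then obtain n where n: "n \<notin> F" "insert n F \<in> cb_deriv G L \<xi>" by blast
        then have "insert n F \<in> cb_deriv G L (g n)" using cb_deriv_antimono[OF \<xi>] by blast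
        moreover have "insert n F \<in> G" using n(2) cb_deriv_subset by blast
        ultimately show False using g[OF n(1) _ L] by blast
      qed
      then show ?thesis by blast
    qed
  qed
  \<comment> \<open>Derivatives are hereditary, so they are empty once the empty set has
    left.\<close>
  then obtain \<xi> where "\<And>L. infinite L \<Longrightarrow> {} \<notin> cb_deriv G L \<xi>" by blast
  then have "\<forall>L. infinite L \<longrightarrow> cb_deriv G L \<xi> = {}"
    using hereditaryD[OF hereditary_cb_deriv[OF her]] by blast
  then show ?thesis ..
qed

section \<open>The dichotomy between closed and non-closed hereditary parts\<close>

theorem theorem3p10:
  fixes \<F> :: "nat set set" and M :: "nat set" and fs :: "omega1 \<Rightarrow> nat \<Rightarrow> omega1"
  assumes "fundamental_sequences fs"
    and "\<F> \<subseteq> Fpow {1..}" and "is_tree \<F>"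
    and "M \<subseteq> {1..}" and "infinite M"
  shows "(\<not> pw_closed (hpart \<F> \<inter> Fpow M) \<longrightarrow> (\<exists>L\<in>infsets M. Fpow L \<subseteq> \<F>)) \<and>
    (pw_closed (hpart \<F> \<inter> Fpow M) \<longrightarrow>
      bdd_above (tree_indices \<F> M) \<and>
      (\<forall>\<xi> :: omega1.
        (tree_index \<F> M > \<xi> + 1 \<longrightarrow>
          (\<exists>L\<in>infsets M. schreier fs \<xi> \<inter> Fpow L \<subseteq> \<F>)) \<and>
        (tree_index \<F> M < \<xi> \<longrightarrow>
          (\<forall>I\<in>infsets M. \<exists>L\<in>infsets I.
            schreier fs \<xi> \<inter> Fpow L \<subseteq> Fpow {1..} - \<F> \<and>
            \<F> \<inter> Fpow L \<subseteq> star (schreier fs \<xi>) - schreier fs \<xi>)) \<and>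
        (tree_index \<F> M = \<xi> + 1 \<or> tree_index \<F> M = \<xi> \<longrightarrow>
          (\<exists>L\<in>infsets M.
            schreier fs \<xi> \<inter> Fpow L \<subseteq> \<F> \<or>
            schreier fs \<xi> \<inter> Fpow L \<subseteq> Fpow {1..} - \<F>))))"
proof -
  note fs = assms(1)
  define G where "G = hpart \<F> \<inter> Fpow M"
  have empty: "{} \<in> \<F>" using assms(3) by (auto simp: is_tree_def star_def)
  have tree: "t \<in> \<F>" if "s \<in> \<F>" "init_seg t s" for s t
  proof -
    have "t \<in> Fpow {1..}" using that assms(2) by (auto simp: init_seg_def Fpow_def intro: finite_subset)
    then have "t \<in> star \<F>" using that by (auto simp: star_def)
    then show ?thesis using assms(3) by (simp add: is_tree_def)
  qed
  have GF: "G \<subseteq> \<F>" using empty by (auto simp: G_def hpart_def)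
  have GM: "G \<subseteq> Fpow M" by (simp add: G_def)
  have fin: "G \<subseteq> Fpow UNIV" using GM by (auto simp: Fpow_def)
  have her: "hereditary G"
    unfolding hereditary_def G_def hpart_def by (auto simp: Fpow_def intro: finite_subset)
  have GI: "s \<in> G" if "\<And>t. t \<subseteq> s \<Longrightarrow> t \<in> \<F>" "s \<in> Fpow M" for s
    using that by (auto simp: G_def hpart_def)
  have ramsey: "\<exists>L\<in>infsets I. schreier fs \<xi> \<inter> Fpow L \<subseteq> \<F> \<or> schreier fs \<xi> \<inter> Fpow L \<inter> \<F> = {}"
    if "I \<in> infsets M" for I \<xi>
  proof -
    have "infinite I" using that by (simp add: infsets_def)
    from schreier_ramsey[OF fs this, of \<xi> \<F>] show ?thesis by (auto simp: infsets_def)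
  qed
  have compl: "schreier fs \<xi> \<inter> Fpow L \<subseteq> Fpow {1..} - \<F>"
    if "schreier fs \<xi> \<inter> Fpow L \<inter> \<F> = {}" for \<xi> L
    using that schreier_pos[of _ fs \<xi>] by (auto simp: Fpow_def)
  show ?thesis
  proof (cases "pw_closed G")
    case False
    then have "\<exists>L\<in>infsets M. Fpow L \<subseteq> \<F>"
      using not_pw_closed_infinite[OF False her GM] GF by blast
    with False show ?thesis unfolding G_def by argo
  next
    case closed: True
    have indices: "tree_indices \<F> M = (\<lambda>L. scb_index L G) ` infsets M"
      by (simp add: tree_indices_def G_def)
    have scb: "scb L G \<xi> = cb_deriv G L \<xi> \<inter> Fpow L" if "\<xi> \<noteq> 0" "L \<in> infsets M" for L \<xi>
      using scb_eq_cb_deriv[OF her fin, of L \<xi>] that by (simp add: infsets_def)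
    have M: "M \<in> infsets M" using assms(5) by (simp add: infsets_def)
    \<comment> \<open>A single ordinal empties the derivatives on all \<open>L\<close>, which bounds
      the whole set of indices.\<close>
    obtain \<xi>\<^sub>0 where \<xi>\<^sub>0: "\<And>L. infinite L \<Longrightarrow> cb_deriv G L \<xi>\<^sub>0 = {}"
      using cb_deriv_bound[OF her fin pw_closed_no_infinite[OF closed fin]] by blast
    have "scb_index L G \<le> osuc \<xi>\<^sub>0" if L: "L \<in> infsets M" for L
    proof -
      have "cb_deriv G L (osuc \<xi>\<^sub>0) = {}"
        using cb_deriv_antimono[of \<xi>\<^sub>0 "osuc \<xi>\<^sub>0" G L] \<xi>\<^sub>0[of L] L by (auto simp: infsets_def order_less_imp_le)
      then have "scb L G (osuc \<xi>\<^sub>0) = {}" using scb[OF _ L] by simp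
      then show ?thesis unfolding scb_index_def by (intro Least_le) (simp add: one_le_omega1_iff)
    qed
    then have bdd: "bdd_above (tree_indices \<F> M)" by (auto simp: indices bdd_above_def)
    have one: "\<exists>L\<in>infsets M. schreier fs \<xi> \<inter> Fpow L \<subseteq> \<F>" if less: "\<xi> + 1 < tree_index \<F> M" for \<xi>
    proof -
      obtain L where L: "L \<in> infsets M" "osuc \<xi> < scb_index L G"
        using less M less_cSup_iff[OF _ bdd, of "osuc \<xi>"]
        by (auto simp: tree_index_def indices plus_omega1_one)
      \<comment> \<open>The index is the least order with empty derivative, and
        \<open>osuc \<xi>\<close> is below it. By heredity the empty set then survives
        \<open>osuc \<xi>\<close> derivations.\<close>
      have "scb L G (osuc \<xi>) \<noteq> {}"
        using not_less_Least[OF L(2)[unfolded scb_index_def]] by (simp add: one_le_omega1_iff)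
      then have "cb_deriv G L (osuc \<xi>) \<noteq> {}" using scb[OF _ L(1), of "osuc \<xi>"] by auto
      then have "{} \<in> cb_deriv G L (osuc \<xi>)"
        using hereditaryD[OF hereditary_cb_deriv[OF her]] by blast
      moreover have "infinite L" "L \<subseteq> {1..}" using L(1) assms(4) by (auto simp: infsets_def)
      ultimately obtain K where K: "K \<subseteq> L" "infinite K" "\<forall>s\<in>schreier fs \<xi> \<inter> Fpow K. {} \<union> s \<in> G"
        using schreier_subset_if_cb_deriv[OF fs, of L "{}" G \<xi>] by blast
      then have "schreier fs \<xi> \<inter> Fpow K \<subseteq> \<F>" using GF by auto
      moreover have "K \<in> infsets M" using K L(1) by (auto simp: infsets_def)
      ultimately show ?thesis by blast
    qed
    have two: "\<exists>L\<in>infsets I. schreier fs \<xi> \<inter> Fpow L \<subseteq> Fpow {1..} - \<F> \<and>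
            \<F> \<inter> Fpow L \<subseteq> star (schreier fs \<xi>) - schreier fs \<xi>"
      if less: "tree_index \<F> M < \<xi>" and I: "I \<in> infsets M" for \<xi> I
    proof -
      obtain L where L: "L \<in> infsets I"
        and cases: "schreier fs \<xi> \<inter> Fpow L \<subseteq> \<F> \<or> schreier fs \<xi> \<inter> Fpow L \<inter> \<F> = {}"
        using ramsey[OF I] by blast
      have L': "infinite L" "L \<subseteq> {1..}" "L \<subseteq> M" using L I assms(4) by (auto simp: infsets_def)
      \<comment> \<open>Otherwise some \<open>K\<close> has all its members of the Schreier family
        in \<open>G\<close>, so the empty set survives \<xi> derivations on \<open>K\<close>,
        although the index of \<open>K\<close> is below \<xi>.\<close>
      have "\<not> schreier fs \<xi> \<inter> Fpow L \<subseteq> \<F>"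
      proof
        assume sub: "schreier fs \<xi> \<inter> Fpow L \<subseteq> \<F>"
        have "\<exists>K\<subseteq>L. infinite K \<and> (\<forall>s\<in>schreier fs \<xi> \<inter> Fpow K. \<forall>t\<subseteq>s. t \<in> \<F>)"
          by (rule ex_schreier_all_subsets[OF fs L'(1,2) sub tree])
        then obtain K where K: "K \<subseteq> L" "infinite K" "\<forall>s\<in>schreier fs \<xi> \<inter> Fpow K. \<forall>t\<subseteq>s. t \<in> \<F>"
          by (elim exE conjE) (rule that)
        have KM: "K \<in> infsets M" using K L' by (auto simp: infsets_def)
        have "{} \<in> cb_deriv G K \<xi>"
        proof (rule cb_deriv_if_schreier_subset[OF fs K(2) _ her])
          show "K \<subseteq> {1..}" using K L' by blast
          fix s assume s: "s \<in> schreier fs \<xi> \<inter> Fpow K"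
          have "s \<in> Fpow M" using s K(1) L'(3) by (auto simp: Fpow_def)
          moreover have "t \<in> \<F>" if "t \<subseteq> s" for t using K(3) s that by blast
          ultimately show "{} \<union> s \<in> G" using GI[of s] by simp
        qed
        \<comment> \<open>Positivity of \<xi> allows the passage from \<open>cb_deriv\<close> to
          \<open>scb\<close>.\<close>
        moreover have "\<xi> \<noteq> 0" using less by (auto simp: leD)
        ultimately have "{} \<in> scb K G \<xi>" using scb[OF _ KM] by (simp add: Fpow_def)
        moreover have "scb_index K G \<le> \<xi>"
        proof -
          have "scb_index K G \<le> tree_index \<F> M"
            unfolding tree_index_def using KM by (intro cSup_upper[OF _ bdd]) (auto simp: indices)
          then show ?thesis using less by simp
        qed
        moreover have "scb K G (scb_index K G) = {}"
          using LeastI_ex[OF scb_index_exists[OF fin closed K(2)]] by (simp add: scb_index_def)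
        ultimately show False using scb_antimono by blast
      qed
      with cases have disj: "schreier fs \<xi> \<inter> Fpow L \<inter> \<F> = {}" by argo
      have "t \<in> star (schreier fs \<xi>) - schreier fs \<xi>" if t: "t \<in> \<F> \<inter> Fpow L" for t
      proof -
        have "t \<in> Fpow L" using t by blast
        then obtain u where u: "u \<in> schreier fs \<xi> \<inter> Fpow L" "init_seg t u \<or> init_seg u t"
          using schreier_compare[OF fs L'(1,2)] by blast
        \<comment> \<open>In a tree \<open>u\<close> would inherit membership in \<open>\<F>\<close>
          from \<open>t\<close>, contradicting disjointness. So \<open>t\<close> is an initial
          segment of \<open>u\<close>.\<close>
        have "\<not> init_seg u t" using tree[of t u] t u(1) disj by blast
        then have "init_seg t u" using u(2) by blast
        moreover have "t \<in> Fpow {1..}" using t assms(2) by blast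
        ultimately have "t \<in> star (schreier fs \<xi>)" using u(1) by (auto simp: star_def)
        then show ?thesis using t disj by blast
      qed
      then show ?thesis using L compl[OF disj] by blast
    qed
    have three: "\<exists>L\<in>infsets M. schreier fs \<xi> \<inter> Fpow L \<subseteq> \<F> \<or> schreier fs \<xi> \<inter> Fpow L \<subseteq> Fpow {1..} - \<F>" for \<xi>
      using ramsey[OF M, of \<xi>] compl by meson
    show ?thesis
      unfolding G_def[symmetric]
    proof (intro conjI allI impI ballI)
      show "\<exists>L\<in>infsets M. Fpow L \<subseteq> \<F>" if "\<not> pw_closed G" using that closed by blast
    qed (use bdd one two three in blast)+
  qed
qed

end
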